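(* Let $C\ge 1$ be any fixed approximation factor. Any algorithm that, given query access to a graph $G$ with $n$ vertices and $m$ edges, outputs with high constant probability an estimate $\widehat{t}$ with $t(G)/C\le \widehat{t}\le C\cdot t(G)$ (where $t(G)$ is the number of triangles of $G$) must perform at least $$\Omega\!\left(\min\left\{\frac{m^{3/2}}{t(G)},\,m\right\}\right)$$ queries, where the allowed queries are degree queries, pair queries and random new-neighbor queries.
   Context: Queries: a degree query on vertex $v$ returns its degree; a pair query on $(u,v)$ returns whether $(u,v)$ is an edge; a random new-neighbor query on vertex $u$ returns a vertex $v$ such that $(u,v)$ is an edge, where the edge $(u,v)$ is chosen uniformly at random among the edges incident to $u$ that have not yet been observed by the algorithm. The algorithm may also sample vertices uniformly at random. The lower bound is meant in the sense that for every $n$, every $1\le m\le\binom n2$ and every $1\le t\le\min\{\binom n3,m^{3/2}\}$, there is a graph with $n$ vertices, $m$ edges and no triangles and a family of graphs with $n$ vertices, $m$ edges and $\Theta(t)$ triangles such that distinguishing (with high constant probability) the former from a uniformly random member of the family requires that many queries.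
   Formalization: For n ≥ 4 the hard graphs have exactly m edges when 3 ≤ m ≤ κn² (any fixed κ < 1/4), and Θ(m) edges for other m; the literal claim fails there: no triangle-free graph has m > n²/4 edges, and no graph with m ≤ 2 edges has a triangle. *)

theory Defs
  imports "HOL-Probability.Probability"
begin

text \<open>
  A simple graph on the vertex set \<open>{..<n}\<close> is given by its set of edges.
\<close>

type_synonym graph = "nat set set"

definition simple_graph :: "nat \<Rightarrow> graph \<Rightarrow> bool" where
  "simple_graph n E \<longleftrightarrow> E \<subseteq> {e. e \<subseteq> {..<n} \<and> card e = 2}"

definition triangles :: "graph \<Rightarrow> nat" where
  "triangles E = card {T. card T = 3 \<and> (\<forall>u\<in>T. \<forall>v\<in>T. u \<noteq> v \<longrightarrow> {u, v} \<in> E)}"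

definition vertex_degree :: "graph \<Rightarrow> nat \<Rightarrow> nat" where
  "vertex_degree E v = card {e \<in> E. v \<in> e}"

datatype 'o action =
    Degree_Query nat
  | Pair_Query nat nat
  | Neighbor_Query nat
  | Sample_Vertex
  | Output 'o

datatype event =
    Degree_Answer nat nat
  | Pair_Answer nat nat bool
  | Neighbor_Answer nat "nat option"
  | Sampled nat

text \<open>
  A randomized adaptive algorithm chooses its next action, possibly at random, from everything it
  has seen so far. There is no computability or time restriction. The algorithm is allowed to
  depend on \<open>n\<close>, on the number of edges, and on anything else except the input graph.
\<close>

type_synonym 'o algorithm = "event list \<Rightarrow> 'o action pmf"

fun observed_edge :: "event \<Rightarrow> nat set set" where
  "observed_edge (Pair_Answer u v True) = {{u, v}}"
| "observed_edge (Neighbor_Answer u (Some v)) = {{u, v}}"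
| "observed_edge _ = {}"

definition new_neighbors :: "graph \<Rightarrow> event list \<Rightarrow> nat \<Rightarrow> nat set" where
  "new_neighbors E h u = {v. {u, v} \<in> E \<and> {u, v} \<notin> (\<Union>ev\<in>set h. observed_edge ev)}"

text \<open>
  A configuration consists of the history, oldest event first, and of the output once the
  algorithm has halted. A new-neighbor query on a vertex all of whose edges have already been
  observed is answered by \<open>None\<close>.
\<close>

fun perform :: "nat \<Rightarrow> graph \<Rightarrow> event list \<Rightarrow> 'o action \<Rightarrow> (event list \<times> 'o option) pmf" where
  "perform n E h (Degree_Query v) = return_pmf (h @ [Degree_Answer v (vertex_degree E v)], None)"
| "perform n E h (Pair_Query u v) = return_pmf (h @ [Pair_Answer u v ({u, v} \<in> E)], None)"
| "perform n E h (Neighbor_Query u) =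
     (if new_neighbors E h u = {} then return_pmf (h @ [Neighbor_Answer u None], None)
      else map_pmf (\<lambda>v. (h @ [Neighbor_Answer u (Some v)], None)) (pmf_of_set (new_neighbors E h u)))"
| "perform n E h Sample_Vertex = map_pmf (\<lambda>v. (h @ [Sampled v], None)) (pmf_of_set {..<n})"
| "perform n E h (Output x) = return_pmf (h, Some x)"

primrec run :: "'o algorithm \<Rightarrow> nat \<Rightarrow> graph \<Rightarrow> nat \<Rightarrow> (event list \<times> 'o option) pmf" where
  "run A n E 0 = return_pmf ([], None)"
| "run A n E (Suc k) =
     bind_pmf (run A n E k) (\<lambda>(h, r).
       case r of
         Some x \<Rightarrow> return_pmf (h, Some x)
       | None \<Rightarrow> bind_pmf (A h) (perform n E h))"

text \<open>
  Termination is not required. The events below increase with the number \<open>k\<close> of steps, so the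
  supremum is the probability that the algorithm halts at all with an output in \<open>S\<close>.
\<close>

definition output_prob :: "'o algorithm \<Rightarrow> nat \<Rightarrow> graph \<Rightarrow> 'o set \<Rightarrow> real" where
  "output_prob A n E S =
     (SUP k. measure_pmf.prob (run A n E k) {(h, r). \<exists>x\<in>S. r = Some x})"

text \<open>Vertex samples are free: only degree, pair and new-neighbor queries are counted.\<close>

definition num_queries :: "event list \<Rightarrow> nat" where
  "num_queries h = length (filter (\<lambda>ev. \<forall>v. ev \<noteq> Sampled v) h)"

text \<open>The worst-case number of queries of \<open>A\<close> on \<open>E\<close> is at least \<open>x\<close>.\<close>

definition queries_at_least :: "'o algorithm \<Rightarrow> nat \<Rightarrow> graph \<Rightarrow> real \<Rightarrow> bool" where
  "queries_at_least A n E x \<longleftrightarrow>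
     (\<exists>k. \<exists>(h, r) \<in> set_pmf (run A n E k). x \<le> real (num_queries h))"

definition estimates_triangles :: "real \<Rightarrow> real \<Rightarrow> nat \<Rightarrow> nat \<Rightarrow> real algorithm \<Rightarrow> bool" where
  "estimates_triangles C p n m A \<longleftrightarrow>
     (\<forall>G. simple_graph n G \<and> card G = m \<longrightarrow>
        p \<le> output_prob A n G {x. real (triangles G) / C \<le> x \<and> x \<le> C * real (triangles G)})"

text \<open>The output \<open>True\<close> is the claim that the input graph is from the family \<open>F\<close>.\<close>

definition distinguishes :: "real \<Rightarrow> nat \<Rightarrow> graph \<Rightarrow> graph set \<Rightarrow> bool algorithm \<Rightarrow> bool" where
  "distinguishes p n G0 F A \<longleftrightarrow>
     p \<le> output_prob A n G0 {False} \<and>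
     p \<le> measure_pmf.expectation (pmf_of_set F) (\<lambda>G. output_prob A n G {True})"

end

theory Submission
  imports Defs
begin

text \<open>
  If two graphs have the same degrees, then an algorithm that has not touched any pair in which they
  differ has seen the same thing, with the same probability, on both; this includes the answers to
  new-neighbor queries, since the numbers of unobserved neighbours agree. Hence a family of graphs
  with the degrees of \<open>G0\<close>, such that every pair is changed with probability at most \<open>\<rho>\<close> in a
  random member, requires \<open>\<Omega>(1 / \<rho>)\<close> queries.

  With \<open>q\<close> of order \<open>sqrt m\<close>, take two copies of \<open>K\<^bsub>q,q\<^esub>\<close> with sides \<open>U\<close>, \<open>P\<close> and \<open>V\<close>, \<open>Q\<close>, join
  \<open>U \<union> V\<close> to a set \<open>W\<close> of \<open>\<tau> \<le> q\<close> vertices, and add a disjoint bipartite graph to obtain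
  \<open>m\<close> edges. For random \<open>k\<close>-subsets of \<open>U\<close>, \<open>P\<close>, \<open>V\<close>, \<open>Q\<close> replace the edges in the two copies
  between these subsets by edges across. This creates exactly \<open>k\<^sup>2 * \<tau>\<close> triangles and changes every
  pair with probability at most \<open>k\<^sup>2 / q\<^sup>2\<close>. Choose \<open>k = 1\<close>, \<open>\<tau> = t\<close> if \<open>t \<le> q\<close>, and \<open>\<tau> = q\<close>,
  \<open>k\<^sup>2 \<approx> t / q\<close> otherwise. For \<open>t\<close> of order \<open>m\<^bsup>3/2\<^esup>\<close> the bound is constant, and one only has to
  see that some query is necessary.
\<close>

section \<open>Coupling runs on two graphs\<close>

definition is_query :: "event \<Rightarrow> bool" where
  "is_query e \<longleftrightarrow> (\<forall>v. e \<noteq> Sampled v)"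

lemma num_queries_eq: "num_queries h = length (filter is_query h)"
  by (simp add: num_queries_def is_query_def[abs_def])

definition output_in :: "'o set \<Rightarrow> (event list \<times> 'o option) set" where
  "output_in S = {(h, r). \<exists>x\<in>S. r = Some x}"

lemma output_prob_eq: "output_prob A n E S = (SUP k. measure_pmf.prob (run A n E k) (output_in S))"
  by (simp add: output_prob_def output_in_def)

lemma perform_cases:
  assumes "(h', r) \<in> set_pmf (perform n E h a)"
  obtains e where "h' = h @ [e]" "r = None" "is_query e \<longleftrightarrow> a \<noteq> Sample_Vertex" "\<forall>x. a \<noteq> Output x"
  | x where "h' = h" "r = Some x" "a = Output x"
  using assms by (cases a) (auto simp: is_query_def split: if_splits)

lemma set_pmf_run_Suc:
  "(h, r) \<in> set_pmf (run A n E (Suc k)) \<longleftrightarrow>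
     ((h, r) \<in> set_pmf (run A n E k) \<and> r \<noteq> None) \<or>
     (\<exists>h' a. (h', None) \<in> set_pmf (run A n E k) \<and> a \<in> set_pmf (A h') \<and>
        (h, r) \<in> set_pmf (perform n E h' a))"
  by (force split: option.splits)

text \<open>A step appends at most one event, so a run whose history extends \<open>h1 @ [e]\<close>
  once stood at \<open>h1\<close> without output and appended \<open>e\<close> there. This serves to
  return to the moment of a first bad event.\<close>

lemma run_prefix:
  assumes "(h1 @ e # h2, r) \<in> set_pmf (run A n E k)"
  shows "\<exists>k' a. (h1, None) \<in> set_pmf (run A n E k') \<and> a \<in> set_pmf (A h1) \<and>
    (h1 @ [e], None) \<in> set_pmf (perform n E h1 a)"
  using assms
proof (induction k arbitrary: h2 r)
  case 0
  then show ?case by simp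
next
  case (Suc k)
  from Suc.prems[unfolded set_pmf_run_Suc] show ?case
  proof (elim disjE exE conjE)
    fix h' a
    assume h': "(h', None) \<in> set_pmf (run A n E k)" "a \<in> set_pmf (A h')"
      and pf: "(h1 @ e # h2, r) \<in> set_pmf (perform n E h' a)"
    from pf show ?case
    proof (cases rule: perform_cases)
      case (1 d)
      show ?thesis
      proof (cases h2 rule: rev_cases)
        case Nil
        with 1 h' pf show ?thesis by auto
      next
        case (snoc h3 e')
        with 1 have "h' = h1 @ e # h3" by simp
        with Suc.IH h' show ?thesis by blast
      qed
    next
      case 2
      with Suc.IH h' show ?thesis by blast
    qed
  qed (use Suc.IH in blast)
qed

text \<open>The history of a predecessor is a prefix of the current one and hence good as well, so
  agreement of single steps between good histories propagates through the induction on
  \<open>k\<close>.\<close>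

lemma pmf_run_eq:
  fixes A :: "'o algorithm"
  assumes "\<And>h a h' (r :: 'o option). list_all good h \<Longrightarrow> list_all good h' \<Longrightarrow>
      pmf (perform n G h a) (h', r) = pmf (perform n G0 h a) (h', r)"
    and "list_all good h"
  shows "pmf (run A n G k) (h, r) = pmf (run A n G0 k) (h, r)"
  using assms(2)
proof (induction k arbitrary: h r)
  case 0
  then show ?case by simp
next
  case (Suc k)
  define st where "st E = (\<lambda>(h, r). case r of
         Some x \<Rightarrow> return_pmf (h, Some x)
       | None \<Rightarrow> bind_pmf (A h) (perform n E h))" for E
  \<comment> \<open>All possible predecessors of \<open>(h, r)\<close>: itself if the run had
    already halted, \<open>(h, None)\<close> if the output has just been made, and
    \<open>(butlast h, None)\<close> if an event was appended. The expectation thus becomes a finite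
    sum.\<close>
  define X where "X = {h, butlast h} \<times> {None, r}"
  have good_X: "list_all good (fst x)" if "x \<in> X" for x
    using that Suc.prems in_set_butlastD[of _ h] by (fastforce simp: X_def list_all_iff)
  have supp: "x \<in> X" if "pmf (st E x) (h, r) \<noteq> 0" for E x
  proof -
    from that have "(h, r) \<in> set_pmf (st E x)" by (simp add: set_pmf_iff)
    then show ?thesis
      by (cases x; cases "snd x") (auto simp: st_def X_def elim!: perform_cases)
  qed
  have run_sum: "pmf (run A n E (Suc k)) (h, r) = (\<Sum>x\<in>X. pmf (run A n E k) x * pmf (st E x) (h, r))" for E
  proof -
    have "pmf (run A n E (Suc k)) (h, r) = measure_pmf.expectation (run A n E k) (\<lambda>x. pmf (st E x) (h, r))"
      by (simp add: pmf_bind st_def)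
    also have "\<dots> = (\<Sum>x\<in>X. pmf (run A n E k) x * pmf (st E x) (h, r))"
      by (subst integral_measure_pmf[of X]) (auto simp: supp, simp add: X_def)
    finally show ?thesis .
  qed
  have eq: "pmf (run A n G k) x * pmf (st G x) (h, r) = pmf (run A n G0 k) x * pmf (st G0 x) (h, r)"
    if "x \<in> X" for x
  proof -
    obtain h' r' where x: "x = (h', r')" by fastforce
    have good: "list_all good h'" using good_X[OF that] x by simp
    have "pmf (st G x) (h, r) = pmf (st G0 x) (h, r)"
      by (cases r') (simp_all add: x st_def pmf_bind assms(1)[OF good Suc.prems])
    with Suc.IH[OF good] x show ?thesis by simp
  qed
  have "(\<Sum>x\<in>X. pmf (run A n G k) x * pmf (st G x) (h, r)) =
      (\<Sum>x\<in>X. pmf (run A n G0 k) x * pmf (st G0 x) (h, r))"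
    by (rule sum.cong) (use eq in auto)
  then show ?case by (simp only: run_sum)
qed

lemma measure_pmf_eq_on:
  assumes "\<And>x. x \<in> S \<Longrightarrow> pmf M x = pmf N x"
  shows "measure_pmf.prob M S = measure_pmf.prob N S"
  unfolding measure_pmf_conv_infsetsum by (rule infsetsum_cong[OF assms refl])

lemma prob_output_mono:
  "measure_pmf.prob (run A n E k) (output_in S) \<le> measure_pmf.prob (run A n E (Suc k)) (output_in S)"
proof -
  define st where "st = (\<lambda>(h, r). case r of
         Some x \<Rightarrow> return_pmf (h, Some x)
       | None \<Rightarrow> bind_pmf (A h) (perform n E h))"
  have *: "indicator (output_in S) x \<le> emeasure (st x) (output_in S)" for x :: "event list \<times> 'a option"
    by (cases x) (auto simp: st_def output_in_def indicator_def split: option.split)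
  have "(\<integral>\<^sup>+x. indicator (output_in S) x \<partial>run A n E k)
      \<le> (\<integral>\<^sup>+x. emeasure (st x) (output_in S) \<partial>run A n E k)"
    by (intro nn_integral_mono *)
  then have "emeasure (run A n E k) (output_in S) \<le> emeasure (run A n E (Suc k)) (output_in S)"
    by (simp add: st_def)
  then show ?thesis
    by (simp add: measure_pmf.emeasure_eq_measure del: run.simps)
qed

text \<open>Monotonicity turns the supremum into a limit, so that an inequality between sums over
  several graphs passes from every \<open>k\<close> to the output probabilities.\<close>

lemma prob_output_LIMSEQ:
  "(\<lambda>k. measure_pmf.prob (run A n E k) (output_in S)) \<longlonglongrightarrow> output_prob A n E S"
  unfolding output_prob_eq
  by (intro LIMSEQ_incseq_SUP bdd_aboveI[of _ 1] incseq_SucI prob_output_mono)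
     (auto simp del: run.simps)

lemma output_prob_mono:
  assumes "S \<subseteq> T"
  shows "output_prob A n E S \<le> output_prob A n E T"
  by (rule LIMSEQ_le[OF prob_output_LIMSEQ prob_output_LIMSEQ])
     (use assms in \<open>auto intro!: exI[of _ 0] measure_pmf.finite_measure_mono simp: output_in_def simp del: run.simps\<close>)

section \<open>Indistinguishability when bad events are rare\<close>

lemma finite_simple_graph: "simple_graph n E \<Longrightarrow> finite E"
  unfolding simple_graph_def by (rule finite_subset[of _ "Pow {..<n}"]) auto

lemma finite_neighbors:
  assumes "simple_graph n E"
  shows "finite {v. {u, v} \<in> E}"
  by (rule finite_subset[of _ "{..<n}"]) (use assms in \<open>auto simp: simple_graph_def\<close>)

lemma finite_new_neighbors:
  assumes "simple_graph n E"
  shows "finite (new_neighbors E h u)"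
  by (rule finite_subset[OF _ finite_neighbors[OF assms, of u]]) (auto simp: new_neighbors_def)

text \<open>Allows an action that leads to a bad query on one graph to be replayed on another, where
  it costs a query too. Finiteness of the neighborhoods ensures that \<open>pmf_of_set\<close> has
  the set itself as its support.\<close>

lemma perform_query_exists:
  assumes "simple_graph n E" and "\<And>x. a \<noteq> Output x" and "a \<noteq> Sample_Vertex"
  shows "\<exists>e. is_query e \<and> (h @ [e], None) \<in> set_pmf (perform n E h a)"
  using assms finite_new_neighbors[OF assms(1)]
  by (cases a) (auto simp: is_query_def)

text \<open>
  On histories all of whose events are good, a run behaves on \<open>G\<close> exactly as on \<open>G0\<close>; so only the
  at most \<open>q\<close> queries up to the first bad one matter, and these can be observed on \<open>G0\<close>,
  independently of the choice of \<open>G\<close>.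
\<close>

lemma indistinguishable:
  fixes A :: "'o algorithm"
  assumes "finite F" "F \<noteq> {}"
    and simple: "\<And>G. G \<in> F \<Longrightarrow> simple_graph n G"
    and perf: "\<And>G h a h' (r :: 'o option). G \<in> F \<Longrightarrow> list_all (good G) h \<Longrightarrow> list_all (good G) h' \<Longrightarrow>
      pmf (perform n G h a) (h', r) = pmf (perform n G0 h a) (h', r)"
    and sampled: "\<And>G e. G \<in> F \<Longrightarrow> \<not> is_query e \<Longrightarrow> good G e"
    and rare: "\<And>e. real (card {G \<in> F. \<not> good G e}) \<le> \<rho> * real (card F)"
    and few: "\<And>G k h r. G \<in> F \<Longrightarrow> (h, r) \<in> set_pmf (run A n G k) \<Longrightarrow> num_queries h \<le> q"
    and disj: "S0 \<inter> S1 = {}"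
  shows "output_prob A n G0 S0 + (\<Sum>G\<in>F. output_prob A n G S1) / real (card F) \<le> 1 + real q * \<rho>"
proof -
  have cF: "real (card F) > 0" using assms(1,2) by (simp add: card_gt_0_iff)
  have "\<rho> \<ge> 0"
    using order_trans[OF of_nat_0_le_iff rare[of undefined]] cF by (simp add: zero_le_mult_iff)
  \<comment> \<open>Only the first \<open>q\<close> queries are inspected, so that a union bound
    over at most \<open>q\<close> events applies.\<close>
  define bad :: "graph \<Rightarrow> (event list \<times> 'o option) set" where "bad G = {hr. \<exists>e\<in>set (take q (filter is_query (fst hr))). \<not> good G e}" for G
  let ?good = "\<lambda>G. {hr. list_all (good G) (fst hr)}"
  have run_eq: "pmf (run A n G k) (h, r) = pmf (run A n G0 k) (h, r)"
    if "G \<in> F" "list_all (good G) h" for G k h r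
    by (rule pmf_run_eq[where good = "good G"]) (simp_all add: perf that)
  \<comment> \<open>The history \<open>h1\<close> before the first bad event \<open>e\<close> is
    good and thus also reachable on \<open>G\<close>. The action that produced \<open>e\<close>
    makes a query there as well, so the budget on \<open>G\<close> leaves fewer than
    \<open>q\<close> queries in \<open>h1\<close>, and \<open>e\<close> is among the first
    \<open>q\<close>.\<close>
  have bad_sub: "hr \<in> bad G"
    if G: "G \<in> F" and hr: "hr \<in> set_pmf (run A n G0 k)" "hr \<notin> ?good G" for G k and hr :: "event list \<times> 'o option"
  proof -
    obtain h r where hr_eq: "hr = (h, r)" by fastforce
    from hr(2) have "\<exists>e\<in>set h. \<not> good G e" by (auto simp: hr_eq list_all_iff)
    then obtain h1 e h2 where h: "h = h1 @ e # h2" "\<not> good G e" "\<forall>d\<in>set h1. good G d"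
      using split_list_first_prop[of h "\<lambda>e. \<not> good G e"] by auto
    from run_prefix[OF hr(1)[unfolded hr_eq h(1)]] obtain k' a
      where a: "(h1, None) \<in> set_pmf (run A n G0 k')" "a \<in> set_pmf (A h1)"
        "(h1 @ [e], None) \<in> set_pmf (perform n G0 h1 a)" by blast
    have "is_query e" using h(2) sampled G by blast
    with a(3) have "a \<noteq> Sample_Vertex \<and> (\<forall>x. a \<noteq> Output x)"
      by (cases rule: perform_cases) auto
    with perform_query_exists[OF simple[OF G]] obtain e'
      where e': "is_query e'" "(h1 @ [e'], None) \<in> set_pmf (perform n G h1 a)" by blast
    have "pmf (run A n G k') (h1, None) = pmf (run A n G0 k') (h1, None)"
      by (rule run_eq[OF G]) (use h(3) in \<open>auto simp: list_all_iff\<close>)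
    with a(1) have "(h1, None) \<in> set_pmf (run A n G k')" by (simp add: set_pmf_iff)
    with a(2) e' have "(h1 @ [e'], None) \<in> set_pmf (run A n G (Suc k'))"
      unfolding set_pmf_run_Suc by blast
    from few[OF G this] e'(1) have "length (filter is_query h1) < q" by (simp add: num_queries_eq)
    then have "e \<in> set (take q (filter is_query h))"
      using \<open>is_query e\<close> by (simp add: h(1) take_Cons')
    with h(2) show ?thesis by (auto simp: bad_def hr_eq)
  qed
  have step: "measure_pmf.prob (run A n G0 k) (output_in S0)
      + (\<Sum>G\<in>F. measure_pmf.prob (run A n G k) (output_in S1)) / real (card F) \<le> 1 + real q * \<rho>" for k
  proof -
    let ?P = "measure_pmf.prob (run A n G0 k)"
    have single: "measure_pmf.prob (run A n G k) (output_in S1) \<le> ?P (output_in S1) + ?P (bad G)"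
      if G: "G \<in> F" for G
    proof -
      let ?Q = "measure_pmf.prob (run A n G k)"
      have eq: "?Q S = ?P S" if "S \<subseteq> ?good G" for S
      proof (rule measure_pmf_eq_on)
        fix x assume "x \<in> S"
        then show "pmf (run A n G k) x = pmf (run A n G0 k) x"
          using that run_eq[OF G, of "fst x" k "snd x"] by auto
      qed
      have "?Q (output_in S1) \<le> ?Q (output_in S1 \<inter> ?good G \<union> - ?good G)"
        by (rule measure_pmf.finite_measure_mono) auto
      also have "\<dots> \<le> ?Q (output_in S1 \<inter> ?good G) + ?Q (- ?good G)"
        by (rule measure_Un_le) auto
      also have "?Q (output_in S1 \<inter> ?good G) = ?P (output_in S1 \<inter> ?good G)"
        by (rule eq) auto
      also have "\<dots> \<le> ?P (output_in S1)"
        by (rule measure_pmf.finite_measure_mono) auto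
      \<comment> \<open>Good histories have the same mass on both graphs, hence so do their
        complements; this moves the exceptional event to the run on \<open>G0\<close>, which does
        not depend on \<open>G\<close>.\<close>
      also have "?Q (- ?good G) = ?P (- ?good G)"
        using eq[OF order_refl] measure_pmf.prob_compl[of "?good G" "run A n G k"]
          measure_pmf.prob_compl[of "?good G" "run A n G0 k"] by (simp add: Compl_eq_Diff_UNIV del: run.simps)
      also have "\<dots> \<le> ?P (bad G)"
        by (rule measure_pmf.finite_measure_mono_AE) (use bad_sub[OF G] in \<open>auto simp: AE_measure_pmf_iff\<close>)
      finally show ?thesis by simp
    qed
    \<comment> \<open>The history is fixed first and the members of \<open>F\<close> are counted
      afterwards: each of its first \<open>q\<close> queries is bad for at most a fraction
      \<open>\<rho>\<close> of them.\<close>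
    have "(\<Sum>G\<in>F. ?P (bad G)) = measure_pmf.expectation (run A n G0 k) (\<lambda>hr. \<Sum>G\<in>F. indicator (bad G) hr)"
      by (subst Bochner_Integration.integral_sum)
         (auto intro!: measure_pmf.integrable_const_bound[where B = 1])
    also have "\<dots> \<le> measure_pmf.expectation (run A n G0 k) (\<lambda>_. real q * (\<rho> * real (card F)))"
    proof (rule integral_mono)
      show "integrable (run A n G0 k) (\<lambda>hr. \<Sum>G\<in>F. indicator (bad G) hr :: real)"
        by (intro Bochner_Integration.integrable_sum measure_pmf.integrable_const_bound[where B = 1]) auto
    next
      fix hr :: "event list \<times> 'o option"
      let ?L = "take q (filter is_query (fst hr))"
      have "(\<Sum>G\<in>F. indicator (bad G) hr :: real) = real (card {G \<in> F. hr \<in> bad G})"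
        using assms(1) by (simp add: indicator_def of_bool_def sum.If_cases Int_def)
      also have "{G \<in> F. hr \<in> bad G} = (\<Union>e\<in>set ?L. {G \<in> F. \<not> good G e})"
        by (auto simp: bad_def)
      also have "real (card \<dots>) \<le> (\<Sum>e\<in>set ?L. real (card {G \<in> F. \<not> good G e}))"
        using card_UN_le[of "set ?L" "\<lambda>e. {G \<in> F. \<not> good G e}"] by (simp flip: of_nat_sum)
      also have "\<dots> \<le> (\<Sum>e\<in>set ?L. \<rho> * real (card F))"
        by (intro sum_mono rare)
      also have "\<dots> = real (card (set ?L)) * (\<rho> * real (card F))" by simp
      also have "\<dots> \<le> real q * (\<rho> * real (card F))"
      proof (rule mult_right_mono)
        have "card (set ?L) \<le> q" by (rule order_trans[OF card_length]) simp
        then show "real (card (set ?L)) \<le> real q" by simp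
      qed (use \<open>\<rho> \<ge> 0\<close> in simp)
      finally show "(\<Sum>G\<in>F. indicator (bad G) hr :: real) \<le> real q * (\<rho> * real (card F))" .
    qed simp
    finally have bad_sum: "(\<Sum>G\<in>F. ?P (bad G)) \<le> real q * (\<rho> * real (card F))" by simp
    have "?P (output_in S0) + ?P (output_in S1) = ?P (output_in S0 \<union> output_in S1)"
      by (rule measure_pmf.finite_measure_Union[symmetric]) (use disj in \<open>auto simp: output_in_def\<close>)
    also have "\<dots> \<le> 1" by simp
    finally have le1: "?P (output_in S0) + ?P (output_in S1) \<le> 1" .
    have "(\<Sum>G\<in>F. measure_pmf.prob (run A n G k) (output_in S1)) \<le> (\<Sum>G\<in>F. ?P (output_in S1) + ?P (bad G))"
      by (intro sum_mono single)
    also have "\<dots> \<le> real (card F) * (?P (output_in S1) + real q * \<rho>)"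
      using bad_sum by (simp add: sum.distrib algebra_simps)
    finally have "(\<Sum>G\<in>F. measure_pmf.prob (run A n G k) (output_in S1)) / real (card F)
        \<le> ?P (output_in S1) + real q * \<rho>"
      using cF by (simp add: divide_le_eq mult.commute)
    with le1 show ?thesis by linarith
  qed
  have "(\<lambda>k. measure_pmf.prob (run A n G0 k) (output_in S0)
      + (\<Sum>G\<in>F. measure_pmf.prob (run A n G k) (output_in S1)) / real (card F))
    \<longlonglongrightarrow> output_prob A n G0 S0 + (\<Sum>G\<in>F. output_prob A n G S1) / real (card F)"
    using cF by (intro tendsto_intros prob_output_LIMSEQ) auto
  then show ?thesis
    by (rule LIMSEQ_le_const2) (use step in blast)
qed

text \<open>If no member reaches \<open>x\<close> queries, the largest integer below
  \<open>x\<close> is a common budget for all of them; it remains to refute such a budget.\<close>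

lemma queries_at_least_of_few:
  assumes "\<And>q. (\<And>G k h r. G \<in> F \<Longrightarrow> (h, r) \<in> set_pmf (run A n G k) \<Longrightarrow> num_queries h \<le> q) \<Longrightarrow>
      real q < x \<Longrightarrow> False"
    and "0 < x"
  shows "\<exists>G\<in>F. queries_at_least A n G x"
proof (rule ccontr)
  assume "\<not> ?thesis"
  then have less: "real (num_queries h) < x" if "G \<in> F" "(h, r) \<in> set_pmf (run A n G k)" for G k h r
    using that by (force simp: queries_at_least_def)
  define q where "q = nat (\<lceil>x\<rceil> - 1)"
  show False
  proof (rule assms(1))
    fix G k h r assume "G \<in> F" "(h, r) \<in> set_pmf (run A n G k)"
    from less[OF this] show "num_queries h \<le> q" unfolding q_def by linarith
  next
    show "real q < x" using assms(2) unfolding q_def by linarith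
  qed
qed

text \<open>Every query event is declared bad, so \<open>\<rho> = 1\<close>, and a budget below
  \<open>x \<le> 1\<close> means \<open>q = 0\<close>. Histories of samples alone tell nothing about
  the graph, which would force \<open>2 * p \<le> 1\<close>.\<close>

lemma one_query_needed:
  fixes A :: "'o algorithm"
  assumes "finite F" "F \<noteq> {}" "\<And>G. G \<in> F \<Longrightarrow> simple_graph n G" "S0 \<inter> S1 = {}"
    and "1 / 2 < p" "p \<le> output_prob A n G0 S0" "p \<le> (\<Sum>G\<in>F. output_prob A n G S1) / real (card F)"
    and "0 < x" "x \<le> 1"
  shows "\<exists>G\<in>F. queries_at_least A n G x"
proof (rule queries_at_least_of_few[OF _ \<open>0 < x\<close>])
  fix q
  assume few: "\<And>G k h r. G \<in> F \<Longrightarrow> (h, r) \<in> set_pmf (run A n G k) \<Longrightarrow> num_queries h \<le> q" and "real q < x"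
  with \<open>x \<le> 1\<close> have "q = 0" by simp
  have perf: "pmf (perform n G h a) (h', r) = pmf (perform n G0 h a) (h', r)"
    if "list_all (\<lambda>e. \<not> is_query e) h" "list_all (\<lambda>e. \<not> is_query e) h'" for G h h' r and a :: "'o action"
  proof (cases "a = Sample_Vertex \<or> (\<exists>x. a = Output x)")
    case False
    then have "(h', r) \<notin> set_pmf (perform n E h a)" for E
      using that(2) by (auto elim!: perform_cases)
    then show ?thesis by (simp add: set_pmf_iff)
  qed auto
  have "output_prob A n G0 S0 + (\<Sum>G\<in>F. output_prob A n G S1) / real (card F) \<le> 1 + real q * 1"
  proof (rule indistinguishable[where good = "\<lambda>_ e. \<not> is_query e"])
    show "real (card {G \<in> F. \<not> \<not> is_query e}) \<le> 1 * real (card F)" for e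
      using card_mono[of F "{G \<in> F. is_query e}"] assms(1) by auto
    show "pmf (perform n G h a) (h', r) = pmf (perform n G0 h a) (h', r)"
      if "list_all (\<lambda>e. \<not> is_query e) h" "list_all (\<lambda>e. \<not> is_query e) h'"
      for G h h' and a :: "'o action" and r
      using that by (rule perf)
  qed (fact assms few | assumption)+
  with \<open>q = 0\<close> assms show False by simp
qed

section \<open>Degree-preserving changes and the pairs they affect\<close>

fun queried_pairs :: "event \<Rightarrow> nat set set" where
  "queried_pairs (Pair_Answer u v b) = {{u, v}}"
| "queried_pairs (Neighbor_Answer u (Some v)) = {{u, v}}"
| "queried_pairs _ = {}"

definition changed :: "graph \<Rightarrow> graph \<Rightarrow> nat set set" where
  "changed G0 G = (G - G0) \<union> (G0 - G)"

lemma observed_edge_subset: "observed_edge e \<subseteq> queried_pairs e"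
  by (cases e rule: observed_edge.cases) auto

lemma card_neighbors:
  assumes "simple_graph n E"
  shows "card {v. {u, v} \<in> E} = vertex_degree E u"
  unfolding vertex_degree_def
proof (rule bij_betw_same_card)
  have *: "\<exists>v. e = {u, v}" if "e \<in> E" "u \<in> e" for e
  proof -
    from that assms have "card e = 2" by (auto simp: simple_graph_def)
    then obtain x y where "e = {x, y}" by (auto simp: card_2_iff)
    with that show ?thesis by auto
  qed
  show "bij_betw (\<lambda>v. {u, v}) {v. {u, v} \<in> E} {e \<in> E. u \<in> e}"
    using * by (auto simp: bij_betw_def inj_on_def doubleton_eq_iff image_iff)
qed

text \<open>Unlike \<open>observed_edge\<close>, \<open>queried_pairs\<close> also records negative
  pair answers. For a neighbor query, the observed edges are unchanged and the degrees agree, so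
  both graphs offer equally many new neighbors; an answer at an unchanged pair is available in both
  graphs or in neither.\<close>

lemma perform_eq_of_unchanged:
  assumes simple: "simple_graph n G" "simple_graph n G0"
    and deg: "\<And>v. vertex_degree G v = vertex_degree G0 v"
    and h: "list_all (\<lambda>e. queried_pairs e \<inter> changed G0 G = {}) h"
    and h': "list_all (\<lambda>e. queried_pairs e \<inter> changed G0 G = {}) h'"
  shows "pmf (perform n G h a) (h', r) = pmf (perform n G0 h a) (h', r)"
proof (cases a)
  case (Degree_Query v)
  then show ?thesis by (simp add: deg)
next
  case (Pair_Query u v)
  show ?thesis
  proof (cases "{u, v} \<in> G \<longleftrightarrow> {u, v} \<in> G0")
    case False
    \<comment> \<open>An answer at a changed pair would contradict the assumption on
      \<open>h'\<close>, so both probabilities are \<open>0\<close>.\<close>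
    then have "h' \<noteq> h @ [Pair_Answer u v b]" for b
      using h' by (auto simp: changed_def)
    then have "pmf (perform n E h a) (h', r) = 0" for E
      by (auto simp: Pair_Query pmf_return indicator_def)
    then show ?thesis by simp
  qed (simp add: Pair_Query)
next
  case (Neighbor_Query u)
  define Ob where "Ob = (\<Union>e\<in>set h. observed_edge e)"
  define N where "N E = {v. {u, v} \<in> E}" for E :: graph
  have Ob: "Ob \<inter> changed G0 G = {}"
    using h observed_edge_subset unfolding Ob_def list_all_iff by blast
  have nn: "new_neighbors E h u = N E - N Ob" for E
    by (auto simp: new_neighbors_def Ob_def N_def)
  have fin: "finite (N G)" "finite (N G0)"
    using finite_neighbors[OF simple(1)] finite_neighbors[OF simple(2)] by (auto simp: N_def)
  have inter: "N G \<inter> N Ob = N G0 \<inter> N Ob"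
    using Ob by (auto simp: N_def changed_def)
  have "card (N G) = card (N G0)"
    using card_neighbors[OF simple(1), of u] card_neighbors[OF simple(2), of u] deg by (simp add: N_def)
  with inter fin have cards: "card (N G - N Ob) = card (N G0 - N Ob)"
    by (simp add: card_Diff_subset_Int)
  then have empty: "N G - N Ob = {} \<longleftrightarrow> N G0 - N Ob = {}"
    using fin by (metis card_eq_0_iff finite_Diff)
  show ?thesis
  proof (cases "N G - N Ob = {}")
    case True
    with empty show ?thesis by (simp add: Neighbor_Query nn)
  next
    case False
    let ?f = "\<lambda>v. (h @ [Neighbor_Answer u (Some v)], None)"
    have inj: "inj ?f" by (auto simp: inj_def)
    have pf: "perform n E h a = map_pmf ?f (pmf_of_set (N E - N Ob))" if "N E - N Ob \<noteq> {}" for E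
      using that by (simp add: Neighbor_Query nn)
    show ?thesis
    proof (cases "\<exists>v. (h', r) = ?f v")
      case True
      then obtain v where v: "(h', r) = ?f v" by blast
      with h' have "v \<in> N G \<longleftrightarrow> v \<in> N G0" by (auto simp: N_def changed_def)
      moreover have "pmf (perform n E h a) (h', r) = indicator (N E - N Ob) v / real (card (N E - N Ob))"
        if "N E - N Ob \<noteq> {}" "finite (N E)" for E
        using that unfolding pf[OF that(1)] v pmf_map_inj'[OF inj] by (subst pmf_of_set) auto
      ultimately show ?thesis
        using False empty fin cards by (simp add: indicator_def)
    next
      case no: False
      then have "pmf (map_pmf ?f M) (h', r) = 0" for M
        by (auto simp: pmf_eq_0_set_pmf)
      with False empty pf show ?thesis by metis
    qed
  qed
qed auto

text \<open>The two success probabilities add up to at least \<open>2 * p\<close>, whereas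
  \<open>q\<close> queries allow at most \<open>1 + q * \<rho>\<close>: an event concerns at most
  one pair, so it is bad for at most a fraction \<open>\<rho>\<close> of the family.\<close>

lemma queries_needed:
  fixes A :: "'o algorithm"
  assumes "finite F" "F \<noteq> {}" and simple: "\<And>G. G \<in> F \<Longrightarrow> simple_graph n G" "simple_graph n G0"
    and deg: "\<And>G v. G \<in> F \<Longrightarrow> vertex_degree G v = vertex_degree G0 v"
    and rare: "\<And>e. real (card {G \<in> F. e \<in> changed G0 G}) \<le> \<rho> * real (card F)"
    and "S0 \<inter> S1 = {}"
    and "p \<le> output_prob A n G0 S0" "p \<le> (\<Sum>G\<in>F. output_prob A n G S1) / real (card F)"
    and "0 < x" "x * \<rho> < 2 * p - 1"
  shows "\<exists>G\<in>F. queries_at_least A n G x"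
proof (rule queries_at_least_of_few[OF _ \<open>0 < x\<close>])
  fix q
  assume few: "\<And>G k h r. G \<in> F \<Longrightarrow> (h, r) \<in> set_pmf (run A n G k) \<Longrightarrow> num_queries h \<le> q" and "real q < x"
  have "real (card F) > 0" using assms(1,2) by (simp add: card_gt_0_iff)
  then have "\<rho> \<ge> 0"
    using order_trans[OF of_nat_0_le_iff rare[of undefined]] by (simp add: zero_le_mult_iff)
  have "output_prob A n G0 S0 + (\<Sum>G\<in>F. output_prob A n G S1) / real (card F) \<le> 1 + real q * \<rho>"
  proof (rule indistinguishable[where good = "\<lambda>G e. queried_pairs e \<inter> changed G0 G = {}"])
    fix e
    show "real (card {G \<in> F. \<not> queried_pairs e \<inter> changed G0 G = {}}) \<le> \<rho> * real (card F)"
    proof (cases "\<exists>d. queried_pairs e = {d}")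
      case True
      then show ?thesis using rare by auto
    next
      case False
      then have "queried_pairs e = {}" by (cases e rule: queried_pairs.cases) auto
      then show ?thesis using \<open>\<rho> \<ge> 0\<close> by simp
    qed
  next
    show "queried_pairs e \<inter> changed G0 G = {}" if "\<not> is_query e" for G e
      using that by (auto simp: is_query_def)
  next
    fix G h a h' and r :: "'o option"
    assume "G \<in> F" and good: "list_all (\<lambda>e. queried_pairs e \<inter> changed G0 G = {}) h"
      "list_all (\<lambda>e. queried_pairs e \<inter> changed G0 G = {}) h'"
    show "pmf (perform n G h a) (h', r) = pmf (perform n G0 h a) (h', r)"
      by (rule perform_eq_of_unchanged[OF simple(1)[OF \<open>G \<in> F\<close>] simple(2) deg[OF \<open>G \<in> F\<close>] good])
  qed (fact assms few)+
  moreover have "real q * \<rho> \<le> x * \<rho>"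
    using \<open>\<rho> \<ge> 0\<close> \<open>real q < x\<close> by (intro mult_right_mono) auto
  ultimately show False using assms(8,9,11) by linarith
qed

section \<open>Correct answers as disjoint output events\<close>

lemma distinguishesD:
  assumes "distinguishes p n G0 F A" "finite F" "F \<noteq> {}"
  shows "p \<le> output_prob A n G0 {False}" "p \<le> (\<Sum>G\<in>F. output_prob A n G {True}) / real (card F)"
  using assms by (simp_all add: distinguishes_def integral_pmf_of_set)

text \<open>Without triangles the only admissible estimate is \<open>0\<close>; with triangles every
  admissible estimate is positive. An estimator thus separates the two kinds of graphs for any
  \<open>C \<ge> 1\<close>.\<close>

lemma estimates_trianglesD:
  assumes est: "estimates_triangles C p n m A" and "1 \<le> C"
    and G0: "simple_graph n G0" "card G0 = m" "triangles G0 = 0"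
    and F: "finite F" "F \<noteq> {}" "\<And>G. G \<in> F \<Longrightarrow> simple_graph n G \<and> card G = m \<and> 0 < triangles G"
  shows "p \<le> output_prob A n G0 {0}" "p \<le> (\<Sum>G\<in>F. output_prob A n G {x. x \<noteq> 0}) / real (card F)"
proof -
  from est G0 have "p \<le> output_prob A n G0 {x. real (triangles G0) / C \<le> x \<and> x \<le> C * real (triangles G0)}"
    unfolding estimates_triangles_def by blast
  also have "{x. real (triangles G0) / C \<le> x \<and> x \<le> C * real (triangles G0)} = {0}"
    using G0 by auto
  finally show "p \<le> output_prob A n G0 {0}" .
  have "p \<le> output_prob A n G {x. x \<noteq> 0}" if "G \<in> F" for G
  proof -
    from est F(3)[OF that] have "p \<le> output_prob A n G {x. real (triangles G) / C \<le> x \<and> x \<le> C * real (triangles G)}"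
      unfolding estimates_triangles_def by blast
    also have "\<dots> \<le> output_prob A n G {x. x \<noteq> 0}"
      using F(3)[OF that] \<open>1 \<le> C\<close> by (intro output_prob_mono) (auto simp: divide_le_0_iff)
    finally show ?thesis .
  qed
  from sum_mono[OF this] have "real (card F) * p \<le> (\<Sum>G\<in>F. output_prob A n G {x. x \<noteq> 0})"
    by simp
  then show "p \<le> (\<Sum>G\<in>F. output_prob A n G {x. x \<noteq> 0}) / real (card F)"
    using F by (simp add: le_divide_eq card_gt_0_iff mult.commute)
qed

section \<open>Graphs\<close>

definition biclique :: "nat set \<Rightarrow> nat set \<Rightarrow> graph" where
  "biclique A B = {{a, b} | a b. a \<in> A \<and> b \<in> B}"

lemma doubleton_in_biclique: "{x, y} \<in> biclique A B \<longleftrightarrow> x \<in> A \<and> y \<in> B \<or> x \<in> B \<and> y \<in> A"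
  by (auto simp: biclique_def doubleton_eq_iff)

lemma biclique_eq_image: "biclique A B = (\<lambda>(a, b). {a, b}) ` (A \<times> B)"
  by (auto simp: biclique_def)

lemma finite_biclique: "finite A \<Longrightarrow> finite B \<Longrightarrow> finite (biclique A B)"
  by (simp add: biclique_eq_image)

lemma biclique_mono: "A \<subseteq> A' \<Longrightarrow> B \<subseteq> B' \<Longrightarrow> biclique A B \<subseteq> biclique A' B'"
  by (auto simp: biclique_def)

lemma biclique_Int_empty:
  assumes "A \<inter> C = {} \<or> B \<inter> D = {}" "A \<inter> D = {} \<or> B \<inter> C = {}"
  shows "biclique A B \<inter> biclique C D = {}"
proof -
  have False if "e \<in> biclique A B" "e \<in> biclique C D" for e
  proof -
    from that(1) obtain x y where "e = {x, y}" "x \<in> A" "y \<in> B" by (auto simp: biclique_def)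
    with that(2) have "x \<in> C \<and> y \<in> D \<or> x \<in> D \<and> y \<in> C" by (simp add: doubleton_in_biclique)
    with \<open>x \<in> A\<close> \<open>y \<in> B\<close> assms show False by blast
  qed
  then show ?thesis by blast
qed

lemma card_biclique:
  assumes "A \<inter> B = {}"
  shows "card (biclique A B) = card A * card B"
proof -
  have "inj_on (\<lambda>(a, b). {a, b}) (A \<times> B)"
    using assms by (auto simp: inj_on_def doubleton_eq_iff)
  then show ?thesis
    by (simp add: biclique_eq_image card_image card_cartesian_product)
qed

lemma degree_biclique:
  assumes "A \<inter> B = {}"
  shows "vertex_degree (biclique A B) v = (if v \<in> A then card B else if v \<in> B then card A else 0)"
proof -
  consider "v \<in> A" "v \<notin> B" | "v \<notin> A" "v \<in> B" | "v \<notin> A" "v \<notin> B" using assms by auto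
  then show ?thesis
  proof cases
    case 1
    then have "{e \<in> biclique A B. v \<in> e} = (\<lambda>b. {v, b}) ` B"
      by (auto simp: biclique_def)
    then show ?thesis
      using 1 by (simp add: vertex_degree_def card_image inj_on_def doubleton_eq_iff)
  next
    case 2
    then have "{e \<in> biclique A B. v \<in> e} = (\<lambda>b. {b, v}) ` A"
      by (auto simp: biclique_def)
    then show ?thesis
      using 2 by (simp add: vertex_degree_def card_image inj_on_def doubleton_eq_iff)
  next
    case 3
    then have "{e \<in> biclique A B. v \<in> e} = {}"
      by (auto simp: biclique_def)
    then show ?thesis
      using 3 unfolding vertex_degree_def by (simp only: card.empty if_False)
  qed
qed

lemma degree_Un:
  assumes "finite E" "finite E'" "E \<inter> E' = {}"
  shows "vertex_degree (E \<union> E') v = vertex_degree E v + vertex_degree E' v"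
proof -
  have "{e \<in> E \<union> E'. v \<in> e} = {e \<in> E. v \<in> e} \<union> {e \<in> E'. v \<in> e}" by auto
  then show ?thesis
    using assms unfolding vertex_degree_def by (subst card_Un_disjoint[symmetric]) auto
qed

lemma simple_graph_biclique:
  assumes "A \<inter> B = {}" "A \<subseteq> {..<n}" "B \<subseteq> {..<n}"
  shows "simple_graph n (biclique A B)"
proof -
  have "card {a, b} = 2" if "a \<in> A" "b \<in> B" for a b
  proof -
    have "a \<noteq> b" using that assms(1) by auto
    then show ?thesis by simp
  qed
  then show ?thesis using assms(2,3) by (auto simp: simple_graph_def biclique_def)
qed

lemma simple_graph_mono: "simple_graph n E \<Longrightarrow> E' \<subseteq> E \<Longrightarrow> simple_graph n E'"
  by (auto simp: simple_graph_def)

lemma simple_graph_Un: "simple_graph n E \<Longrightarrow> simple_graph n E' \<Longrightarrow> simple_graph n (E \<union> E')"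
  by (auto simp: simple_graph_def)

section \<open>Counting triangles and subsets\<close>

definition triangle_set :: "graph \<Rightarrow> nat set set" where
  "triangle_set E = {T. card T = 3 \<and> (\<forall>u\<in>T. \<forall>v\<in>T. u \<noteq> v \<longrightarrow> {u, v} \<in> E)}"

lemma triangles_eq: "triangles E = card (triangle_set E)"
  by (simp add: triangles_def triangle_set_def)

lemma triangle_setE:
  assumes "T \<in> triangle_set E"
  obtains x y z where "T = {x, y, z}" "x \<noteq> y" "y \<noteq> z" "x \<noteq> z"
    "{x, y} \<in> E" "{y, z} \<in> E" "{x, z} \<in> E"
  using assms unfolding triangle_set_def card_3_iff by auto

lemma triangle_set_mono: "E \<subseteq> E' \<Longrightarrow> triangle_set E \<subseteq> triangle_set E'"
  by (auto simp: triangle_set_def)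

definition complete_graph :: "nat \<Rightarrow> graph" where
  "complete_graph s = {e. e \<subseteq> {..<s} \<and> card e = 2}"

lemma simple_graph_iff: "simple_graph n E \<longleftrightarrow> E \<subseteq> complete_graph n"
  by (simp add: simple_graph_def complete_graph_def)

lemma card_complete_graph: "card (complete_graph s) = s choose 2"
  unfolding complete_graph_def by (simp add: n_subsets)

lemma finite_complete_graph: "finite (complete_graph s)"
  unfolding complete_graph_def by (rule finite_subset[of _ "Pow {..<s}"]) auto

lemma triangle_set_complete_graph: "triangle_set (complete_graph s) = {T. T \<subseteq> {..<s} \<and> card T = 3}"
  (is "?L = ?R")
proof
  show "?L \<subseteq> ?R"
  proof
    fix T assume T: "T \<in> ?L"
    then obtain x y z where "T = {x, y, z}" "{x, y} \<in> complete_graph s" "{y, z} \<in> complete_graph s"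
      by (rule triangle_setE)
    with T show "T \<in> ?R" by (auto simp: complete_graph_def triangle_set_def)
  qed
  show "?R \<subseteq> ?L"
    by (auto simp: triangle_set_def complete_graph_def card_2_iff)
qed

lemma finite_triangle_set: "simple_graph n E \<Longrightarrow> finite (triangle_set E)"
  using triangle_set_mono[of E "complete_graph n"]
  by (auto simp: simple_graph_iff triangle_set_complete_graph intro: finite_subset[of _ "Pow {..<n}"])

lemma triangles_mono: "E \<subseteq> E' \<Longrightarrow> simple_graph n E' \<Longrightarrow> triangles E \<le> triangles E'"
  unfolding triangles_eq by (intro card_mono finite_triangle_set triangle_set_mono)

lemma triangles_complete_graph: "triangles (complete_graph s) = s choose 3"
  by (simp add: triangles_eq triangle_set_complete_graph n_subsets)

lemma triangles_bipartite:
  assumes "A \<inter> B = {}" "E \<subseteq> biclique A B"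
  shows "triangles E = 0"
proof -
  have "triangle_set E = {}"
  proof (rule ccontr)
    assume "triangle_set E \<noteq> {}"
    then obtain T where "T \<in> triangle_set E" by blast
    then obtain x y z where "{x, y} \<in> E" "{y, z} \<in> E" "{x, z} \<in> E" by (rule triangle_setE)
    with assms(2) have "{x, y} \<in> biclique A B" "{y, z} \<in> biclique A B" "{x, z} \<in> biclique A B" by auto
    with assms(1) show False by (auto simp: doubleton_in_biclique)
  qed
  then show ?thesis by (simp add: triangles_eq)
qed

text \<open>Division-free form of the fact that a random \<open>k\<close>-subset of \<open>S\<close>
  contains \<open>x\<close> with probability \<open>k / card S\<close>. Removing \<open>x\<close>
  reduces the count to subsets of size \<open>k - 1\<close>; the absorption identity for binomial
  coefficients concludes.\<close>

lemma card_subsets_containing: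
  assumes "finite S" "x \<in> S"
  shows "card {A. A \<subseteq> S \<and> card A = k \<and> x \<in> A} * card S = k * (card S choose k)"
proof (cases k)
  case 0
  with assms have "{A. A \<subseteq> S \<and> card A = k \<and> x \<in> A} = {}"
    using finite_subset by fastforce
  with 0 show ?thesis by (simp only:) simp
next
  case (Suc j)
  have "{A. A \<subseteq> S \<and> card A = k \<and> x \<in> A} = insert x ` {A. A \<subseteq> S - {x} \<and> card A = j}" (is "?L = ?R")
  proof
    show "?L \<subseteq> ?R"
    proof
      fix A assume "A \<in> ?L"
      with Suc assms have "A = insert x (A - {x})" "A - {x} \<subseteq> S - {x}" "card (A - {x}) = j" by auto
      then show "A \<in> ?R" by blast
    qed
    show "?R \<subseteq> ?L"
    proof clarify
      fix B assume B: "B \<subseteq> S - {x}" "j = card B"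
      then have "finite B" "x \<notin> B" using assms(1) by (auto dest: finite_subset)
      with B Suc assms(2) show "insert x B \<subseteq> S \<and> card (insert x B) = k \<and> x \<in> insert x B" by auto
    qed
  qed
  moreover have "inj_on (insert x) {A. A \<subseteq> S - {x} \<and> card A = j}"
    by (rule inj_onI) (metis (no_types, lifting) Diff_insert_absorb Diff_iff insertI1 mem_Collect_eq subset_iff)
  ultimately have "card {A. A \<subseteq> S \<and> card A = k \<and> x \<in> A} = (card S - 1) choose j"
    using assms by (simp add: card_image n_subsets)
  moreover obtain N where "card S = Suc N"
    using assms by (cases "card S") auto
  ultimately show ?thesis
    using Suc Suc_times_binomial_eq[of N j] by (simp add: mult.commute del: binomial_Suc_Suc)
qed

section \<open>A hidden family of graphs\<close>

text \<open>
  \<open>base\<close> is bipartite with sides \<open>U \<union> V \<union> X\<close> and \<open>P \<union> Q \<union> W \<union> Y\<close>. Swapping the edges between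
  \<open>A\<close>, \<open>B\<close> and between \<open>A'\<close>, \<open>B'\<close> for those between \<open>A\<close>, \<open>A'\<close> and between \<open>B\<close>, \<open>B'\<close> preserves
  all degrees. A vertex of \<open>A\<close> and one of \<open>A'\<close> have exactly \<open>W\<close> as common neighbours, a vertex of
  \<open>B\<close> and one of \<open>B'\<close> have none.
\<close>

locale hidden =
  fixes n q k :: nat and U P V Q W X Y :: "nat set" and E0 :: graph
  assumes disj: "U \<inter> P = {}" "U \<inter> V = {}" "U \<inter> Q = {}" "U \<inter> W = {}" "U \<inter> X = {}" "U \<inter> Y = {}"
      "P \<inter> V = {}" "P \<inter> Q = {}" "P \<inter> W = {}" "P \<inter> X = {}" "P \<inter> Y = {}"
      "V \<inter> Q = {}" "V \<inter> W = {}" "V \<inter> X = {}" "V \<inter> Y = {}"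
      "Q \<inter> W = {}" "Q \<inter> X = {}" "Q \<inter> Y = {}" "W \<inter> X = {}" "W \<inter> Y = {}" "X \<inter> Y = {}"
    and verts: "U \<subseteq> {..<n}" "P \<subseteq> {..<n}" "V \<subseteq> {..<n}" "Q \<subseteq> {..<n}" "W \<subseteq> {..<n}" "X \<subseteq> {..<n}" "Y \<subseteq> {..<n}"
    and cards: "card U = q" "card P = q" "card V = q" "card Q = q"
    and k: "1 \<le> k" "k \<le> q"
    and E0: "E0 \<subseteq> biclique X Y"
begin

definition base :: graph where
  "base = biclique U P \<union> biclique V Q \<union> biclique W (U \<union> V) \<union> E0"

definition removed :: "nat set \<Rightarrow> nat set \<Rightarrow> nat set \<Rightarrow> nat set \<Rightarrow> graph" where
  "removed A B A' B' = biclique A B \<union> biclique A' B'"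

definition added :: "nat set \<Rightarrow> nat set \<Rightarrow> nat set \<Rightarrow> nat set \<Rightarrow> graph" where
  "added A B A' B' = biclique A A' \<union> biclique B B'"

definition swapped :: "nat set \<Rightarrow> nat set \<Rightarrow> nat set \<Rightarrow> nat set \<Rightarrow> graph" where
  "swapped A B A' B' = (base - removed A B A' B') \<union> added A B A' B'"

definition blocks :: "nat set \<Rightarrow> nat set set" where
  "blocks S = {A. A \<subseteq> S \<and> card A = k}"

definition index :: "(nat set \<times> nat set \<times> nat set \<times> nat set) set" where
  "index = blocks U \<times> blocks P \<times> blocks V \<times> blocks Q"

definition family :: "graph set" where
  "family = (\<lambda>(A, B, A', B'). swapped A B A' B') ` index"

lemma exclusive:
  "x \<in> U \<Longrightarrow> x \<notin> P \<and> x \<notin> V \<and> x \<notin> Q \<and> x \<notin> W \<and> x \<notin> X \<and> x \<notin> Y"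
  "x \<in> P \<Longrightarrow> x \<notin> U \<and> x \<notin> V \<and> x \<notin> Q \<and> x \<notin> W \<and> x \<notin> X \<and> x \<notin> Y"
  "x \<in> V \<Longrightarrow> x \<notin> U \<and> x \<notin> P \<and> x \<notin> Q \<and> x \<notin> W \<and> x \<notin> X \<and> x \<notin> Y"
  "x \<in> Q \<Longrightarrow> x \<notin> U \<and> x \<notin> P \<and> x \<notin> V \<and> x \<notin> W \<and> x \<notin> X \<and> x \<notin> Y"
  "x \<in> W \<Longrightarrow> x \<notin> U \<and> x \<notin> P \<and> x \<notin> V \<and> x \<notin> Q \<and> x \<notin> X \<and> x \<notin> Y"
  using disj by (simp_all add: disjoint_iff) metis+

lemma finites: "finite U" "finite P" "finite V" "finite Q" "finite W" "finite X" "finite Y"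
  using verts[THEN finite_subset] by simp_all

lemma base_bipartite: "base \<subseteq> biclique (U \<union> V \<union> X) (P \<union> Q \<union> W \<union> Y)"
  using E0 by (auto simp: base_def biclique_def doubleton_eq_iff; blast)

lemma sides: "(U \<union> V \<union> X) \<inter> (P \<union> Q \<union> W \<union> Y) = {}"
  using disj by (simp add: Int_Un_distrib Int_Un_distrib2 Int_commute)

lemma simple_base: "simple_graph n base"
  by (rule simple_graph_mono[OF simple_graph_biclique base_bipartite]) (use sides verts in auto)

lemma triangles_base: "triangles base = 0"
  by (rule triangles_bipartite[OF sides base_bipartite])

lemma card_base: "card base = 2 * q ^ 2 + 2 * q * card W + card E0"
proof -
  have "biclique U P \<inter> biclique V Q = {}" "biclique U P \<inter> biclique W (U \<union> V) = {}"
    "biclique V Q \<inter> biclique W (U \<union> V) = {}"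
    using disj by (auto intro!: biclique_Int_empty simp: Int_Un_distrib Int_commute)
  moreover have "biclique U P \<inter> biclique X Y = {}" "biclique V Q \<inter> biclique X Y = {}"
    "biclique W (U \<union> V) \<inter> biclique X Y = {}"
    using disj by (auto intro!: biclique_Int_empty)
  then have "biclique U P \<inter> E0 = {}" "biclique V Q \<inter> E0 = {}" "biclique W (U \<union> V) \<inter> E0 = {}"
    using E0 by blast+
  moreover have "finite E0" using finite_subset[OF E0] finites finite_biclique by blast
  ultimately have "card base =
      card (biclique U P) + card (biclique V Q) + card (biclique W (U \<union> V)) + card E0"
    unfolding base_def
    using finites by (simp add: card_Un_disjoint finite_biclique Int_Un_distrib2)
  moreover have "card (biclique W (U \<union> V)) = card W * (card U + card V)"
    using disj finites by (simp add: card_biclique card_Un_disjoint Int_Un_distrib Int_commute)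
  ultimately show ?thesis
    using disj by (simp add: card_biclique cards power2_eq_square algebra_simps)
qed

section \<open>The effect of a single swap\<close>

context
  fixes A B A' B' :: "nat set"
  assumes idx: "(A, B, A', B') \<in> index"
begin

lemma sub: "A \<subseteq> U" "B \<subseteq> P" "A' \<subseteq> V" "B' \<subseteq> Q"
  and card_block: "card A = k" "card B = k" "card A' = k" "card B' = k"
  using idx by (auto simp: index_def blocks_def)

lemma finite_block: "finite A" "finite B" "finite A'" "finite B'"
  using sub finites by (auto dest: finite_subset)

lemma disj_block: "A \<inter> B = {}" "A \<inter> A' = {}" "A \<inter> B' = {}" "B \<inter> A' = {}" "B \<inter> B' = {}" "A' \<inter> B' = {}"
  using sub disj by auto

lemma removed_subset: "removed A B A' B' \<subseteq> base"
  using biclique_mono[OF sub(1,2)] biclique_mono[OF sub(3,4)] by (auto simp: removed_def base_def)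

text \<open>Added edges stay within one side of the bipartition: \<open>A\<close> and
  \<open>A'\<close> lie on one side, \<open>B\<close> and \<open>B'\<close> on the other.\<close>

lemma added_base: "added A B A' B' \<inter> base = {}"
proof -
  have "e \<notin> base" if "e \<in> added A B A' B'" for e
  proof
    assume "e \<in> base"
    then have e: "e \<in> biclique (U \<union> V \<union> X) (P \<union> Q \<union> W \<union> Y)" using base_bipartite by blast
    from that obtain x y where "e = {x, y}" "x \<in> A \<and> y \<in> A' \<or> x \<in> B \<and> y \<in> B'"
      by (auto simp: added_def biclique_def)
    with e sub sides show False by (auto simp: doubleton_in_biclique)
  qed
  then show ?thesis by blast
qed

lemma changed_swapped: "changed base (swapped A B A' B') = removed A B A' B' \<union> added A B A' B'"
  using removed_subset added_base by (auto simp: changed_def swapped_def)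

lemma finite_changes: "finite (removed A B A' B')" "finite (added A B A' B')"
  using finite_block by (auto simp: removed_def added_def intro: finite_biclique)

lemma disj_biclique: "biclique A B \<inter> biclique A' B' = {}" "biclique A A' \<inter> biclique B B' = {}"
  using disj_block by (simp_all add: biclique_Int_empty)

lemma simple_swapped: "simple_graph n (swapped A B A' B')"
proof -
  have "simple_graph n (biclique A A')" "simple_graph n (biclique B B')"
    using disj_block sub verts by (auto intro!: simple_graph_biclique)
  then show ?thesis
    unfolding swapped_def added_def
    by (intro simple_graph_Un simple_graph_mono[OF simple_base Diff_subset])
qed

lemma card_swapped: "card (swapped A B A' B') = card base"
proof -
  have "card (removed A B A' B') = card (added A B A' B')"
    using disj_block disj_biclique finite_block
    by (simp add: removed_def added_def card_Un_disjoint finite_biclique card_biclique card_block)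
  moreover have "card (swapped A B A' B') = card (base - removed A B A' B') + card (added A B A' B')"
    unfolding swapped_def
    by (rule card_Un_disjoint) (use finite_changes finite_simple_graph[OF simple_base] added_base in auto)
  moreover have "card (base - removed A B A' B') + card (removed A B A' B') = card base"
    using removed_subset finite_simple_graph[OF simple_base]
    by (metis add.commute card_Diff_subset card_mono finite_changes(1) le_add_diff_inverse)
  ultimately show ?thesis by simp
qed

text \<open>All blocks have size \<open>k\<close>, so a vertex of a block loses \<open>k\<close>
  edges to its partner block and gains \<open>k\<close> edges to another one. Other vertices meet
  neither removed nor added edges.\<close>

lemma degree_swapped: "vertex_degree (swapped A B A' B') v = vertex_degree base v"
proof -
  have fin: "finite (biclique A B)" "finite (biclique A' B')" "finite (biclique A A')" "finite (biclique B B')"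
    using finite_block by (auto intro: finite_biclique)
  have "vertex_degree (removed A B A' B') v = vertex_degree (added A B A' B') v"
    unfolding removed_def added_def degree_Un[OF fin(1,2) disj_biclique(1)] degree_Un[OF fin(3,4) disj_biclique(2)]
    using disj_block by (auto simp: degree_biclique card_block)
  moreover have "vertex_degree (swapped A B A' B') v =
      vertex_degree (base - removed A B A' B') v + vertex_degree (added A B A' B') v"
    unfolding swapped_def
    by (rule degree_Un) (use finite_changes finite_simple_graph[OF simple_base] added_base in auto)
  moreover have "vertex_degree ((base - removed A B A' B') \<union> removed A B A' B') v =
      vertex_degree (base - removed A B A' B') v + vertex_degree (removed A B A' B') v"
    by (rule degree_Un) (use finite_changes finite_simple_graph[OF simple_base] in auto)
  moreover have "(base - removed A B A' B') \<union> removed A B A' B' = base"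
    using removed_subset by blast
  ultimately show ?thesis by simp
qed

lemma edge_swapped:
  "{x, y} \<in> swapped A B A' B' \<longleftrightarrow>
     {x, y} \<in> base \<and> \<not> (x \<in> A \<and> y \<in> B \<or> x \<in> B \<and> y \<in> A \<or> x \<in> A' \<and> y \<in> B' \<or> x \<in> B' \<and> y \<in> A') \<or>
     x \<in> A \<and> y \<in> A' \<or> x \<in> A' \<and> y \<in> A \<or> x \<in> B \<and> y \<in> B' \<or> x \<in> B' \<and> y \<in> B"
  by (auto simp: swapped_def removed_def added_def doubleton_in_biclique)

lemma edge_base:
  "{x, y} \<in> base \<longleftrightarrow> x \<in> U \<and> y \<in> P \<or> x \<in> P \<and> y \<in> U \<or> x \<in> V \<and> y \<in> Q \<or> x \<in> Q \<and> y \<in> V \<or>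
     x \<in> W \<and> (y \<in> U \<or> y \<in> V) \<or> (x \<in> U \<or> x \<in> V) \<and> y \<in> W \<or> {x, y} \<in> E0"
  by (auto simp: base_def doubleton_in_biclique)

lemma edge_E0: "{x, y} \<in> E0 \<Longrightarrow> x \<in> X \<and> y \<in> Y \<or> x \<in> Y \<and> y \<in> X"
  using E0 doubleton_in_biclique[of x y X Y] by blast

lemma in_A: "x \<in> A \<Longrightarrow> x \<in> U \<and> x \<notin> B \<and> x \<notin> A' \<and> x \<notin> B'"
  and in_B: "x \<in> B \<Longrightarrow> x \<in> P \<and> x \<notin> A \<and> x \<notin> A' \<and> x \<notin> B'"
  and in_A': "x \<in> A' \<Longrightarrow> x \<in> V \<and> x \<notin> A \<and> x \<notin> B \<and> x \<notin> B'"
  and in_B': "x \<in> B' \<Longrightarrow> x \<in> Q \<and> x \<notin> A \<and> x \<notin> B \<and> x \<notin> A'"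
  using sub disj_block by auto

text \<open>These four bounds on neighborhoods are coarse, since removed partners are not excluded,
  but they suffice to locate the common neighbors of the endpoints of an added edge.\<close>

lemma neighbors_A: "x \<in> A \<Longrightarrow> {x, z} \<in> swapped A B A' B' \<Longrightarrow> z \<in> P \<or> z \<in> W \<or> z \<in> A'"
  using in_A[of x] exclusive(1)[of x] edge_E0[of x z] by (auto simp: edge_swapped edge_base)

lemma neighbors_A': "x \<in> A' \<Longrightarrow> {x, z} \<in> swapped A B A' B' \<Longrightarrow> z \<in> Q \<or> z \<in> W \<or> z \<in> A"
  using in_A'[of x] exclusive(3)[of x] edge_E0[of x z] by (auto simp: edge_swapped edge_base)

lemma neighbors_B: "x \<in> B \<Longrightarrow> {x, z} \<in> swapped A B A' B' \<Longrightarrow> z \<in> U \<or> z \<in> B'"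
  using in_B[of x] exclusive(2)[of x] edge_E0[of x z] by (auto simp: edge_swapped edge_base)

lemma neighbors_B': "x \<in> B' \<Longrightarrow> {x, z} \<in> swapped A B A' B' \<Longrightarrow> z \<in> V \<or> z \<in> B"
  using in_B'[of x] exclusive(4)[of x] edge_E0[of x z] by (auto simp: edge_swapped edge_base)

text \<open>An edge within one side of the bipartition must be an added one. Between
  \<open>A\<close> and \<open>A'\<close> the neighborhoods lie in
  \<open>P \<union> W \<union> A'\<close> and \<open>Q \<union> W \<union> A\<close>, which share
  only \<open>W\<close>; between \<open>B\<close> and \<open>B'\<close> they lie in the disjoint
  sets \<open>U \<union> B'\<close> and \<open>V \<union> B\<close>.\<close>

lemma common_neighbor:
  assumes e: "{x, y} \<in> swapped A B A' B'" "{x, z} \<in> swapped A B A' B'" "{y, z} \<in> swapped A B A' B'"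
    and side: "x \<in> U \<union> V \<union> X \<longleftrightarrow> y \<in> U \<union> V \<union> X"
  shows "(x \<in> A \<and> y \<in> A' \<or> x \<in> A' \<and> y \<in> A) \<and> z \<in> W"
proof -
  have "{x, y} \<notin> base"
  proof
    assume "{x, y} \<in> base"
    then have "{x, y} \<in> biclique (U \<union> V \<union> X) (P \<union> Q \<union> W \<union> Y)" using base_bipartite by (rule subsetD[rotated])
    then have "x \<in> U \<union> V \<union> X \<and> y \<in> P \<union> Q \<union> W \<union> Y \<or> x \<in> P \<union> Q \<union> W \<union> Y \<and> y \<in> U \<union> V \<union> X"
      by (simp only: doubleton_in_biclique)
    moreover have "v \<notin> P \<union> Q \<union> W \<union> Y" if "v \<in> U \<union> V \<union> X" for v
      using sides that by (simp only: disjoint_iff) blast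
    ultimately show False using side by metis
  qed
  then have "x \<in> A \<and> y \<in> A' \<or> x \<in> A' \<and> y \<in> A \<or> x \<in> B \<and> y \<in> B' \<or> x \<in> B' \<and> y \<in> B"
    using e(1) edge_swapped[of x y] by simp
  then consider "x \<in> A" "y \<in> A'" | "x \<in> A'" "y \<in> A" | "x \<in> B" "y \<in> B'" | "x \<in> B'" "y \<in> B"
    by argo
  then show ?thesis
  proof cases
    case 1
    with neighbors_A[OF 1(1) e(2)] neighbors_A'[OF 1(2) e(3)] show ?thesis
      by (metis in_A in_A' exclusive(1,2,3))
  next
    case 2
    with neighbors_A[OF 2(2) e(3)] neighbors_A'[OF 2(1) e(2)] show ?thesis
      by (metis in_A in_A' exclusive(1,2,3))
  next
    case 3
    with neighbors_B[OF 3(1) e(2)] neighbors_B'[OF 3(2) e(3)] show ?thesis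
      by (metis in_B in_B' exclusive(1,2,3,4))
  next
    case 4
    with neighbors_B[OF 4(2) e(3)] neighbors_B'[OF 4(1) e(2)] show ?thesis
      by (metis in_B in_B' exclusive(1,2,3,4))
  qed
qed

text \<open>By the pigeonhole principle two vertices of a triangle are on the same side;
  \<open>common_neighbor\<close> applied to them determines the types of all three.\<close>

lemma triangle_set_swapped:
  "triangle_set (swapped A B A' B') = (\<lambda>(a, a', w). {a, a', w}) ` (A \<times> A' \<times> W)"
proof
  show "triangle_set (swapped A B A' B') \<subseteq> (\<lambda>(a, a', w). {a, a', w}) ` (A \<times> A' \<times> W)"
  proof
    fix T assume "T \<in> triangle_set (swapped A B A' B')"
    then obtain x y z where T: "T = {x, y, z}"
      and e: "{x, y} \<in> swapped A B A' B'" "{y, z} \<in> swapped A B A' B'" "{x, z} \<in> swapped A B A' B'"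
      by (rule triangle_setE)
    have e': "{y, x} \<in> swapped A B A' B'" "{z, y} \<in> swapped A B A' B'" "{z, x} \<in> swapped A B A' B'"
      using e by (simp_all add: insert_commute)
    let ?L = "\<lambda>x. x \<in> U \<union> V \<union> X"
    consider "?L x = ?L y" | "?L x = ?L z" | "?L y = ?L z" by blast
    then have "\<exists>a\<in>A. \<exists>a'\<in>A'. \<exists>w\<in>W. T = {a, a', w}"
    proof cases
      case 1
      from common_neighbor[OF e(1) e(3) e(2) 1] show ?thesis unfolding T by blast
    next
      case 2
      from common_neighbor[OF e(3) e(1) e'(2) 2] show ?thesis unfolding T by blast
    next
      case 3
      from common_neighbor[OF e(2) e'(1) e'(3) 3] show ?thesis unfolding T by blast
    qed
    then show "T \<in> (\<lambda>(a, a', w). {a, a', w}) ` (A \<times> A' \<times> W)" by (auto simp: image_iff)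
  qed
  show "(\<lambda>(a, a', w). {a, a', w}) ` (A \<times> A' \<times> W) \<subseteq> triangle_set (swapped A B A' B')"
  proof clarify
    fix a a' w assume a: "a \<in> A" "a' \<in> A'" "w \<in> W"
    have w: "w \<notin> A" "w \<notin> B" "w \<notin> A'" "w \<notin> B'"
      using exclusive(5)[OF a(3)] sub by blast+
    then have "a \<noteq> a'" "a \<noteq> w" "a' \<noteq> w" using a in_A[OF a(1)] by auto
    moreover have "{a, a'} \<in> swapped A B A' B'" "{a, w} \<in> swapped A B A' B'" "{a', w} \<in> swapped A B A' B'"
      using a in_A[OF a(1)] in_A'[OF a(2)] w by (simp_all add: edge_swapped edge_base)
    ultimately show "{a, a', w} \<in> triangle_set (swapped A B A' B')"
      by (simp add: triangle_set_def insert_commute)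
  qed
qed

lemma triangles_swapped: "triangles (swapped A B A' B') = k ^ 2 * card W"
proof -
  have "a = b \<and> a' = b' \<and> w = v"
    if m: "a \<in> A" "a' \<in> A'" "w \<in> W" "b \<in> A" "b' \<in> A'" "v \<in> W" and eq: "{a, a', w} = {b, b', v}"
    for a a' w b b' v
  proof -
    have "a \<in> {b, b', v}" "a' \<in> {b, b', v}" "w \<in> {b, b', v}" using eq by blast+
    then show ?thesis
      using m by (metis in_A in_A' exclusive(5) insertE singletonD)
  qed
  then have "inj_on (\<lambda>(a, a', w). {a, a', w}) (A \<times> A' \<times> W)"
    unfolding inj_on_def by (simp add: split_paired_all)
  then show ?thesis
    by (simp add: triangles_eq triangle_set_swapped card_image card_cartesian_product card_block power2_eq_square)
qed

text \<open>The blocks can be read off the graph, because \<open>base\<close> has no edges between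
  \<open>U\<close> and \<open>V\<close> or between \<open>P\<close> and \<open>Q\<close>. Nonempty
  blocks are needed here: an edge at a vertex of \<open>A\<close> is visible only if
  \<open>A'\<close> has an element.\<close>

lemma blocks_of_swapped:
  "A = {x \<in> U. \<exists>y\<in>V. {x, y} \<in> swapped A B A' B'}" "A' = {x \<in> V. \<exists>y\<in>U. {x, y} \<in> swapped A B A' B'}"
  "B = {x \<in> P. \<exists>y\<in>Q. {x, y} \<in> swapped A B A' B'}" "B' = {x \<in> Q. \<exists>y\<in>P. {x, y} \<in> swapped A B A' B'}"
proof -
  have uv: "{x, y} \<in> swapped A B A' B' \<longleftrightarrow> x \<in> A \<and> y \<in> A'"
    "{y, x} \<in> swapped A B A' B' \<longleftrightarrow> x \<in> A \<and> y \<in> A'" if "x \<in> U" "y \<in> V" for x y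
  proof -
    have "x \<notin> B" "x \<notin> A'" "x \<notin> B'" "y \<notin> A" "y \<notin> B" "y \<notin> B'"
      using that exclusive(1)[of x] exclusive(3)[of y] sub by blast+
    moreover have "{x, y} \<notin> E0" "{y, x} \<notin> E0"
      using that exclusive(1)[of x] edge_E0[of x y] edge_E0[of y x] by blast+
    ultimately show "{x, y} \<in> swapped A B A' B' \<longleftrightarrow> x \<in> A \<and> y \<in> A'"
      "{y, x} \<in> swapped A B A' B' \<longleftrightarrow> x \<in> A \<and> y \<in> A'"
      using that exclusive(1)[of x] exclusive(3)[of y] by (simp_all add: edge_swapped edge_base conj_commute)
  qed
  have pq: "{x, y} \<in> swapped A B A' B' \<longleftrightarrow> x \<in> B \<and> y \<in> B'"
    "{y, x} \<in> swapped A B A' B' \<longleftrightarrow> x \<in> B \<and> y \<in> B'" if "x \<in> P" "y \<in> Q" for x y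
  proof -
    have "x \<notin> A" "x \<notin> A'" "x \<notin> B'" "y \<notin> A" "y \<notin> B" "y \<notin> A'"
      using that exclusive(2)[of x] exclusive(4)[of y] sub by blast+
    moreover have "{x, y} \<notin> E0" "{y, x} \<notin> E0"
      using that exclusive(2)[of x] edge_E0[of x y] edge_E0[of y x] by blast+
    ultimately show "{x, y} \<in> swapped A B A' B' \<longleftrightarrow> x \<in> B \<and> y \<in> B'"
      "{y, x} \<in> swapped A B A' B' \<longleftrightarrow> x \<in> B \<and> y \<in> B'"
      using that exclusive(2)[of x] exclusive(4)[of y] by (simp_all add: edge_swapped edge_base conj_commute)
  qed
  have ne: "A \<noteq> {}" "A' \<noteq> {}" "B \<noteq> {}" "B' \<noteq> {}" using card_block k(1) by auto
  have "{x \<in> U. \<exists>y\<in>V. {x, y} \<in> swapped A B A' B'} = {x \<in> U. \<exists>y\<in>V. x \<in> A \<and> y \<in> A'}"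
    by (intro Collect_cong conj_cong bex_cong refl uv(1))
  with sub ne show "A = {x \<in> U. \<exists>y\<in>V. {x, y} \<in> swapped A B A' B'}" by auto
  have "{x \<in> V. \<exists>y\<in>U. {x, y} \<in> swapped A B A' B'} = {x \<in> V. \<exists>y\<in>U. y \<in> A \<and> x \<in> A'}"
    by (intro Collect_cong conj_cong bex_cong refl uv(2))
  with sub ne show "A' = {x \<in> V. \<exists>y\<in>U. {x, y} \<in> swapped A B A' B'}" by auto
  have "{x \<in> P. \<exists>y\<in>Q. {x, y} \<in> swapped A B A' B'} = {x \<in> P. \<exists>y\<in>Q. x \<in> B \<and> y \<in> B'}"
    by (intro Collect_cong conj_cong bex_cong refl pq(1))
  with sub ne show "B = {x \<in> P. \<exists>y\<in>Q. {x, y} \<in> swapped A B A' B'}" by auto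
  have "{x \<in> Q. \<exists>y\<in>P. {x, y} \<in> swapped A B A' B'} = {x \<in> Q. \<exists>y\<in>P. y \<in> B \<and> x \<in> B'}"
    by (intro Collect_cong conj_cong bex_cong refl pq(2))
  with sub ne show "B' = {x \<in> Q. \<exists>y\<in>P. {x, y} \<in> swapped A B A' B'}" by auto
qed

end

text \<open>A uniform member of \<open>family\<close> therefore amounts to a uniform and independent
  choice of the four blocks.\<close>

lemma inj_on_swapped: "inj_on (\<lambda>(A, B, A', B'). swapped A B A' B') index"
proof -
  have "A = C \<and> B = D \<and> A' = C' \<and> B' = D'"
    if i: "(A, B, A', B') \<in> index" "(C, D, C', D') \<in> index" and eq: "swapped A B A' B' = swapped C D C' D'"
    for A B A' B' C D C' D'
    using blocks_of_swapped[OF i(1), unfolded eq, folded blocks_of_swapped[OF i(2)]] by simp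
  then show ?thesis
    unfolding inj_on_def by (simp add: split_paired_all)
qed

section \<open>The size of the family and the frequency of a changed pair\<close>

lemma finite_blocks: "finite S \<Longrightarrow> finite (blocks S)"
  unfolding blocks_def by (rule finite_subset[of _ "Pow S"]) auto

lemma card_blocks: "finite S \<Longrightarrow> card (blocks S) = card S choose k"
  by (simp add: blocks_def n_subsets)

lemma finite_index: "finite index"
  unfolding index_def using finites by (intro finite_cartesian_product finite_blocks)

lemma card_index: "card index = (q choose k) ^ 4"
  using finites by (simp add: index_def card_cartesian_product card_blocks cards power4_eq_xxxx)

lemma finite_family: "finite family"
  by (simp add: family_def finite_index)

lemma card_family: "card family = (q choose k) ^ 4"
  by (simp add: family_def card_image[OF inj_on_swapped] card_index)

lemma family_nonempty: "family \<noteq> {}"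
proof -
  have "card family > 0" using k by (simp add: card_family zero_less_binomial)
  then show ?thesis by auto
qed

lemma familyE:
  assumes "G \<in> family"
  obtains A B A' B' where "(A, B, A', B') \<in> index" "G = swapped A B A' B'"
  using assms by (auto simp: family_def)

text \<open>A pair is changed only if both endpoints lie in chosen blocks. The endpoints belong to
  two different sets among \<open>U\<close>, \<open>P\<close>, \<open>V\<close>, \<open>Q\<close>,
  so these are independent events, each of probability \<open>k / q\<close>.\<close>

lemma card_changed_index:
  "card {(A, B, A', B') \<in> index. e \<in> removed A B A' B' \<union> added A B A' B'} * q ^ 2 \<le> k ^ 2 * (q choose k) ^ 4"
  (is "card ?I * _ \<le> _")
proof (cases "?I = {}")
  case True
  then show ?thesis by (simp only: card.empty)
next
  case False
  define N where "N = q choose k"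
  define c where "c S x = {A \<in> blocks S. x \<in> A}" for S and x :: nat
  have fin: "finite (c S x)" "finite (blocks S)" if "finite S" for S x
    using finite_blocks[OF that] by (auto simp: c_def)
  have c: "card (c S x) * q = k * N" if "x \<in> S" "finite S" "card S = q" for S x
    using card_subsets_containing[OF that(2,1), of k] that(3) by (simp add: c_def blocks_def N_def conj_assoc)
  have N: "card (blocks S) = N" if "finite S" "card S = q" for S
    using that by (simp add: card_blocks N_def)
  \<comment> \<open>In each case two of the four factors are restricted to blocks through an
    endpoint of \<open>e\<close>, with \<open>a\<close> and \<open>b\<close> choices, while the
    other two remain free with \<open>N\<close> choices each.\<close>
  have main: "card ?I * q ^ 2 \<le> k ^ 2 * N ^ 4"
    if sub: "?I \<subseteq> S1 \<times> S2 \<times> S3 \<times> S4" and fin: "finite (S1 \<times> S2 \<times> S3 \<times> S4)"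
      and eq: "card (S1 \<times> S2 \<times> S3 \<times> S4) = a * b * N ^ 2" and a: "a * q = k * N" and b: "b * q = k * N"
    for S1 S2 S3 S4 :: "nat set set" and a b
  proof -
    have "card ?I * q ^ 2 \<le> (a * b * N ^ 2) * q ^ 2"
      using card_mono[OF fin sub] unfolding eq by simp
    also have "\<dots> = (a * q) * (b * q) * N ^ 2" by (simp add: power2_eq_square)
    also have "\<dots> = k ^ 2 * N ^ 4" unfolding a b by (simp add: power2_eq_square power4_eq_xxxx)
    finally show ?thesis .
  qed
  \<comment> \<open>A single member of the set already reveals in which of the sets
    \<open>U\<close>, \<open>P\<close>, \<open>V\<close>, \<open>Q\<close> the endpoints of
    \<open>e\<close> lie.\<close>
  from False obtain A B A' B' where i: "(A, B, A', B') \<in> index" "e \<in> removed A B A' B' \<union> added A B A' B'"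
    by auto
  from i(2) obtain x y where e: "e = {x, y}"
    and xy: "x \<in> A \<and> y \<in> B \<or> x \<in> A' \<and> y \<in> B' \<or> x \<in> A \<and> y \<in> A' \<or> x \<in> B \<and> y \<in> B'"
    by (auto simp: removed_def added_def biclique_def)
  with sub[OF i(1)] consider "x \<in> U" "y \<in> P" | "x \<in> V" "y \<in> Q" | "x \<in> U" "y \<in> V" | "x \<in> P" "y \<in> Q"
    by blast
  then have "card ?I * q ^ 2 \<le> k ^ 2 * N ^ 4"
  proof cases
    case 1
    have "?I \<subseteq> c U x \<times> c P y \<times> blocks V \<times> blocks Q"
      using 1 exclusive(1)[of x] exclusive(2)[of y] unfolding e by (auto simp: index_def c_def blocks_def removed_def added_def doubleton_in_biclique)
    then show ?thesis
      by (rule main[where a = "card (c U x)" and b = "card (c P y)"])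
         (use 1 finites in \<open>auto simp: fin c N cards card_cartesian_product power2_eq_square\<close>)
  next
    case 2
    have "?I \<subseteq> blocks U \<times> blocks P \<times> c V x \<times> c Q y"
      using 2 exclusive(3)[of x] exclusive(4)[of y] unfolding e by (auto simp: index_def c_def blocks_def removed_def added_def doubleton_in_biclique)
    then show ?thesis
      by (rule main[where a = "card (c V x)" and b = "card (c Q y)"])
         (use 2 finites in \<open>auto simp: fin c N cards card_cartesian_product power2_eq_square\<close>)
  next
    case 3
    have "?I \<subseteq> c U x \<times> blocks P \<times> c V y \<times> blocks Q"
      using 3 exclusive(1)[of x] exclusive(3)[of y] unfolding e by (auto simp: index_def c_def blocks_def removed_def added_def doubleton_in_biclique)
    then show ?thesis
      by (rule main[where a = "card (c U x)" and b = "card (c V y)"])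
         (use 3 finites in \<open>auto simp: fin c N cards card_cartesian_product power2_eq_square\<close>)
  next
    case 4
    have "?I \<subseteq> blocks U \<times> c P x \<times> blocks V \<times> c Q y"
      using 4 exclusive(2)[of x] exclusive(4)[of y] unfolding e by (auto simp: index_def c_def blocks_def removed_def added_def doubleton_in_biclique)
    then show ?thesis
      by (rule main[where a = "card (c P x)" and b = "card (c Q y)"])
         (use 4 finites in \<open>auto simp: fin c N cards card_cartesian_product power2_eq_square\<close>)
  qed
  then show ?thesis by (simp add: N_def)
qed

lemma changed_rarely:
  "real (card {G \<in> family. e \<in> changed base G}) \<le> (real k ^ 2 / real q ^ 2) * real (card family)"
proof -
  let ?I = "{(A, B, A', B') \<in> index. e \<in> removed A B A' B' \<union> added A B A' B'}"
  have sub: "{G \<in> family. e \<in> changed base G} \<subseteq> (\<lambda>(A, B, A', B'). swapped A B A' B') ` ?I"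
  proof (rule subsetI)
    fix G assume "G \<in> {G \<in> family. e \<in> changed base G}"
    then have G: "G \<in> family" "e \<in> changed base G" by simp_all
    from G(1) obtain A B A' B' where i: "(A, B, A', B') \<in> index" "G = swapped A B A' B'"
      by (rule familyE)
    with G(2) have "e \<in> removed A B A' B' \<union> added A B A' B'"
      using changed_swapped[OF i(1)] by simp
    with i(1) have "(A, B, A', B') \<in> ?I" by simp
    from imageI[OF this, of "\<lambda>(A, B, A', B'). swapped A B A' B'"] i(2)
    show "G \<in> (\<lambda>(A, B, A', B'). swapped A B A' B') ` ?I" by simp
  qed
  have fin: "finite ?I" by (rule finite_subset[OF _ finite_index]) auto
  have "card {G \<in> family. e \<in> changed base G} \<le> card ?I"
    by (rule order_trans[OF card_mono[OF finite_imageI[OF fin] sub] card_image_le[OF fin]])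
  then have "card {G \<in> family. e \<in> changed base G} * q ^ 2 \<le> card ?I * q ^ 2"
    by (rule mult_le_mono1)
  also have "\<dots> \<le> k ^ 2 * card family"
    unfolding card_family by (rule card_changed_index)
  finally have "real (card {G \<in> family. e \<in> changed base G} * q ^ 2) \<le> real (k ^ 2 * card family)"
    by (rule of_nat_mono)
  then have "real (card {G \<in> family. e \<in> changed base G}) * real q ^ 2 \<le> real k ^ 2 * real (card family)"
    by simp
  then show ?thesis
    using k by (simp add: pos_le_divide_eq)
qed

end

text \<open>The first \<open>5 * q\<close> vertices accommodate \<open>U\<close>, \<open>P\<close>,
  \<open>V\<close>, \<open>Q\<close> and \<open>W\<close>; the next \<open>2 * f\<close> form
  \<open>X\<close> and \<open>Y\<close>. A suitable subset of the \<open>f^2\<close> possible edges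
  between \<open>X\<close> and \<open>Y\<close> brings the number of edges to exactly
  \<open>m\<close>.\<close>

lemma hidden_family_exists:
  assumes "1 \<le> k" "k \<le> q" "\<tau> \<le> q" and n: "5 * q + 2 * f \<le> n"
    and m: "2 * q ^ 2 + 2 * q * \<tau> \<le> m" "m \<le> 2 * q ^ 2 + 2 * q * \<tau> + f ^ 2"
  shows "\<exists>G0 F. finite F \<and> F \<noteq> {} \<and> simple_graph n G0 \<and> card G0 = m \<and> triangles G0 = 0 \<and>
    (\<forall>G\<in>F. simple_graph n G \<and> card G = m \<and> triangles G = k ^ 2 * \<tau> \<and>
       (\<forall>v. vertex_degree G v = vertex_degree G0 v)) \<and>
    (\<forall>e. real (card {G \<in> F. e \<in> changed G0 G}) \<le> (real k ^ 2 / real q ^ 2) * real (card F))"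
proof -
  define X where "X = {5 * q..<5 * q + f}"
  define Y where "Y = {5 * q + f..<5 * q + 2 * f}"
  have "card (biclique X Y) = f ^ 2"
    by (subst card_biclique) (auto simp: X_def Y_def power2_eq_square)
  with m(2) have "m - (2 * q ^ 2 + 2 * q * \<tau>) \<le> card (biclique X Y)" by simp
  then obtain E0 where edges: "E0 \<subseteq> biclique X Y" "card E0 = m - (2 * q ^ 2 + 2 * q * \<tau>)"
    by (rule obtain_subset_with_card_n)
  interpret hidden n q k "{..<q}" "{q..<2 * q}" "{2 * q..<3 * q}" "{3 * q..<4 * q}" "{4 * q..<4 * q + \<tau>}" X Y E0
    by unfold_locales (use assms edges(1) in \<open>auto simp: X_def Y_def\<close>)
  have "card base = m"
    using card_base edges(2) m(1) by simp
  moreover have "simple_graph n G \<and> card G = card base \<and> triangles G = k ^ 2 * \<tau> \<and>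
      (\<forall>v. vertex_degree G v = vertex_degree base v)" if G: "G \<in> family" for G
  proof -
    from G obtain A B A' B' where i: "(A, B, A', B') \<in> index" "G = swapped A B A' B'" by (rule familyE)
    show ?thesis
      unfolding i(2) using simple_swapped[OF i(1)] card_swapped[OF i(1)] triangles_swapped[OF i(1)]
        degree_swapped[OF i(1)] by simp
  qed
  ultimately show ?thesis
    using finite_family family_nonempty simple_base triangles_base changed_rarely
    by (intro exI[of _ base] exI[of _ family]) simp
qed

section \<open>Graphs with a prescribed number of edges and many or no triangles\<close>

lemma real_choose_2: "real (s choose 2) = real s * (real s - 1) / 2"
  by (induction s) (simp_all add: numeral_2_eq_2 field_simps)

lemma real_choose_3: "real (s choose 3) = real s * (real s - 1) * (real s - 2) / 6"
proof (induction s)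
  case (Suc s)
  have "Suc s choose 3 = (s choose 2) + (s choose 3)" by (simp add: numeral_3_eq_3 numeral_2_eq_2)
  then show ?case using Suc by (simp add: real_choose_2 field_simps)
qed simp

lemma powr_three_halves: "0 \<le> x \<Longrightarrow> x powr (3 / 2) = sqrt x ^ 3"
proof -
  assume "0 \<le> x"
  have "x powr (3 / 2) = x powr (1 / 2 * 3)" by simp
  also have "\<dots> = sqrt x powr 3"
    using \<open>0 \<le> x\<close> by (simp only: powr_powr[symmetric] powr_half_sqrt)
  also have "\<dots> = sqrt x ^ 3"
    using \<open>0 \<le> x\<close> by (subst powr_numeral) simp_all
  finally show ?thesis .
qed

text \<open>The graph lies between the complete graphs on \<open>s\<close> and \<open>s + 1\<close>
  vertices, where \<open>s\<close> is the largest number with \<open>s choose 2 \<le> m\<close>. It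
  is the instance for \<open>t\<close> of order \<open>m^(3/2)\<close>.\<close>

lemma clique_like_graph_exists:
  assumes "3 \<le> m" "real m \<le> real n ^ 2 / 4" "4 \<le> n"
  shows "\<exists>G. simple_graph n G \<and> card G = m \<and>
    sqrt (real m) ^ 3 / 27 \<le> real (triangles G) \<and> real (triangles G) \<le> sqrt (real m) ^ 3"
proof -
  have "m < Suc (Suc m) choose 2" by (simp add: numeral_2_eq_2)
  moreover have "\<not> m < 0 choose 2" by (simp add: binomial_eq_0)
  ultimately obtain s where s: "\<not> m < s choose 2" "m < Suc s choose 2"
    using ex_least_nat_less[of "\<lambda>s. m < s choose 2" "Suc (Suc m)"] by blast
  have "3 \<le> s"
  proof (rule ccontr)
    assume "\<not> 3 \<le> s"
    then consider "s = 0" | "s = 1" | "s = 2" by linarith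
    then show False using s(2) assms(1) by cases (simp_all add: numeral_2_eq_2)
  qed
  then have rs: "real s \<ge> 3" by simp
  have lo: "real s * (real s - 1) / 2 \<le> real m"
    using s(1) by (simp flip: real_choose_2)
  have hi: "real m < (real s + 1) * real s / 2"
    using s(2) real_choose_2[of "Suc s"] by (simp add: add.commute flip: of_nat_less_iff[where 'a = real])
  \<comment> \<open>Otherwise \<open>n * (n - 1) / 2 \<le> m \<le> n^2 / 4\<close>, which fails for
    \<open>n \<ge> 4\<close>. So \<open>s + 1\<close> vertices are available.\<close>
  have "s < n"
  proof (rule ccontr)
    assume "\<not> s < n"
    then have "real n * (real n - 1) \<le> real s * (real s - 1)"
      using assms(3) by (intro mult_mono) auto
    with lo assms(2) have "real n * (real n - 2) \<le> 0"
      by (simp add: power2_eq_square algebra_simps)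
    with assms(3) show False by (simp add: mult_le_0_iff)
  qed
  have "complete_graph s \<subseteq> complete_graph (Suc s)" by (auto simp: complete_graph_def)
  moreover have "card (complete_graph s) \<le> m" "m \<le> card (complete_graph (Suc s))"
    using s by (simp_all add: card_complete_graph)
  ultimately obtain G where G: "complete_graph s \<subseteq> G" "G \<subseteq> complete_graph (Suc s)" "card G = m"
    using exists_subset_between[of "complete_graph s" m "complete_graph (Suc s)"] finite_complete_graph by blast
  have simple: "simple_graph (Suc s) G" using G(2) by (simp add: simple_graph_iff)
  have "complete_graph (Suc s) \<subseteq> complete_graph n" using \<open>s < n\<close> by (auto simp: complete_graph_def)
  with G(2) have "simple_graph n G" by (simp add: simple_graph_iff)
  have "s choose 3 \<le> triangles G"
    using triangles_mono[OF G(1) simple] by (simp add: triangles_complete_graph)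
  then have tri_lo: "real s * (real s - 1) * (real s - 2) / 6 \<le> real (triangles G)"
    by (simp flip: real_choose_3)
  have "triangles G \<le> Suc s choose 3"
    using triangles_mono[OF G(2), of "Suc s"] by (simp add: triangles_complete_graph simple_graph_iff)
  then have "real (triangles G) \<le> real (Suc s choose 3)" by (rule of_nat_mono)
  then have tri_hi: "real (triangles G) \<le> (real s + 1) * real s * (real s - 1) / 6"
    by (simp add: real_choose_3 add.commute)
  define r where "r = sqrt (real m)"
  have r: "0 \<le> r" "r ^ 2 = real m" by (simp_all add: r_def)
  have "(real s + 1) * real s \<le> 2 * real s * real s"
    using rs by (intro mult_right_mono) auto
  then have "r ^ 2 \<le> real s ^ 2"
    using hi r(2) unfolding power2_eq_square by linarith
  then have "r \<le> real s" using power2_le_imp_le by fastforce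
  then have "r ^ 3 \<le> real s ^ 3" using r(1) by (intro power_mono)
  \<comment> \<open>The constant \<open>27\<close> is sharp at \<open>s = 3\<close>: there
    \<open>s choose 3\<close> is \<open>1\<close> and \<open>s^3\<close> is
    \<open>27\<close>.\<close>
  moreover have "27 * (real s * (real s - 1) * (real s - 2)) - 6 * real s ^ 3 = 3 * (real s * ((real s - 3) * (7 * real s - 6)))"
    by (simp add: algebra_simps power3_eq_cube)
  moreover have "real s * ((real s - 3) * (7 * real s - 6)) \<ge> 0" using rs by simp
  ultimately have 1: "r ^ 3 / 27 \<le> real (triangles G)" using tri_lo by argo
  have "real s ^ 2 / 3 \<le> real s * (real s - 1) / 2"
    using rs by (simp add: power2_eq_square field_simps)
  with lo r(2) have "real s ^ 2 \<le> 3 * r ^ 2" by simp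
  \<comment> \<open>\<open>9 / 5\<close> is slightly more than \<open>sqrt 3\<close>, and its cube
    \<open>729 / 125\<close> is still less than the \<open>6\<close> in the denominator of
    \<open>tri_hi\<close>.\<close>
  also have "\<dots> \<le> (9 / 5 * r) ^ 2" by (simp add: power2_eq_square)
  finally have "real s \<le> 9 / 5 * r" by (rule power2_le_imp_le) (use r(1) in simp)
  then have "real s ^ 3 \<le> (9 / 5 * r) ^ 3" by (intro power_mono) auto
  also have "\<dots> = (729 / 125) * r ^ 3" by (simp add: power3_eq_cube)
  finally have "real s ^ 3 \<le> (729 / 125) * r ^ 3" .
  moreover have "(real s + 1) * real s * (real s - 1) \<le> real s ^ 3"
    by (simp add: power3_eq_cube algebra_simps)
  ultimately have 2: "real (triangles G) \<le> r ^ 3" using tri_hi r(1) zero_le_power[of r 3] by argo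
  from 1 2 \<open>simple_graph n G\<close> G(3) show ?thesis unfolding r_def by blast
qed

text \<open>The balanced complete bipartite graph has \<open>n^2 / 4\<close> edges, rounded down,
  and any subset of them is triangle-free.\<close>

lemma triangle_free_graph_exists:
  assumes "real m \<le> real n ^ 2 / 4"
  shows "\<exists>G. simple_graph n G \<and> card G = m \<and> triangles G = 0"
proof -
  define j where "j = n div 2"
  have "4 * m \<le> n ^ 2" using assms by (simp add: field_simps flip: of_nat_power of_nat_le_iff[where 'a = real])
  have "m \<le> j * (n - j)"
  proof (cases "even n")
    case True
    then have "n = 2 * j" by (simp add: j_def)
    with \<open>4 * m \<le> n ^ 2\<close> show ?thesis by (simp add: power2_eq_square)
  next
    case False
    then have "n = 2 * j + 1" by (simp add: j_def)
    with \<open>4 * m \<le> n ^ 2\<close> show ?thesis by (simp add: power2_eq_square algebra_simps)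
  qed
  also have "\<dots> = card (biclique {..<j} {j..<n})" by (subst card_biclique) auto
  finally obtain G where G: "G \<subseteq> biclique {..<j} {j..<n}" "card G = m"
    by (rule obtain_subset_with_card_n)
  moreover have "triangles G = 0"
    by (rule triangles_bipartite[OF _ G(1)]) auto
  moreover have "simple_graph n (biclique {..<j} {j..<n})"
    by (rule simple_graph_biclique) (auto simp: j_def)
  ultimately show ?thesis
    using simple_graph_mono by blast
qed

section \<open>The lower bound\<close>

definition hard :: "real \<Rightarrow> real \<Rightarrow> nat \<Rightarrow> nat \<Rightarrow> real \<Rightarrow> graph \<Rightarrow> graph set \<Rightarrow> bool" where
  "hard C p n m c G0 F \<longleftrightarrow>
     (\<forall>A. distinguishes p n G0 F A \<longrightarrow>
        (\<exists>G\<in>F. queries_at_least A n G (c * min (real m powr (3 / 2) / real (triangles G)) (real m)))) \<and>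
     (\<forall>A. estimates_triangles C p n m A \<longrightarrow>
        (\<exists>G\<in>F. queries_at_least A n G (c * min (real m powr (3 / 2) / real (triangles G)) (real m))))"

text \<open>If the bound is at most \<open>1\<close>, then nothing but the necessity of a query is claimed.\<close>

lemma hard_single:
  assumes "1 \<le> C" "1 / 2 < p" "0 < c" "0 < m"
    and G0: "simple_graph n G0" "card G0 = m" "triangles G0 = 0"
    and G: "simple_graph n G" "card G = m" "0 < triangles G"
    and small: "c * real m powr (3 / 2) \<le> real (triangles G)"
  shows "hard C p n m c G0 {G}"
proof -
  define x where "x = c * min (real m powr (3 / 2) / real (triangles G)) (real m)"
  have "0 < x" using assms by (simp add: x_def)
  have "x \<le> c * (real m powr (3 / 2) / real (triangles G))"
    unfolding x_def using assms(3) by (intro mult_left_mono) auto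
  also have "\<dots> \<le> 1" using small G(3) by (simp add: divide_le_eq)
  finally have "x \<le> 1" .
  have simple: "simple_graph n H" if "H \<in> {G}" for H using that G by simp
  have "\<exists>G\<in>{G}. queries_at_least A n G x" if "distinguishes p n G0 {G} A" for A
    by (rule one_query_needed[of _ n "{False}" "{True}" p, OF _ _ simple])
       (use distinguishesD[OF that] assms \<open>0 < x\<close> \<open>x \<le> 1\<close> in auto)
  moreover have "\<exists>G\<in>{G}. queries_at_least A n G x" if "estimates_triangles C p n m A" for A
    by (rule one_query_needed[of _ n "{0}" "{x. x \<noteq> 0}" p, OF _ _ simple])
       (use estimates_trianglesD[OF that assms(1) G0, of "{G}"] G assms \<open>0 < x\<close> \<open>x \<le> 1\<close> in auto)
  ultimately show ?thesis unfolding hard_def x_def by blast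
qed

text \<open>All members have the same number \<open>T\<close> of triangles, so the claimed bound is
  one number \<open>x\<close> for the whole family and \<open>queries_needed\<close> applies to
  it.\<close>

lemma hard_family:
  assumes "1 \<le> C" "0 < c" "0 < m" "finite F" "F \<noteq> {}" "0 < T"
    and G0: "simple_graph n G0" "card G0 = m" "triangles G0 = 0"
    and F: "\<And>G. G \<in> F \<Longrightarrow> simple_graph n G \<and> card G = m \<and> triangles G = T"
    and deg: "\<And>G v. G \<in> F \<Longrightarrow> vertex_degree G v = vertex_degree G0 v"
    and rare: "\<And>e. real (card {G \<in> F. e \<in> changed G0 G}) \<le> \<rho> * real (card F)"
    and small: "c * min (real m powr (3 / 2) / real T) (real m) * \<rho> < 2 * p - 1"
  shows "hard C p n m c G0 F"
proof -
  define x where "x = c * min (real m powr (3 / 2) / real T) (real m)"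
  have "0 < x" using assms(2,3,6) by (simp add: x_def)
  have simple: "simple_graph n G" if "G \<in> F" for G using F[OF that] by simp
  have "\<exists>G\<in>F. queries_at_least A n G x" if "distinguishes p n G0 F A" for A
    by (rule queries_needed[OF assms(4,5) simple G0(1) deg rare, where ?S0.0 = "{False}" and ?S1.0 = "{True}" and p = p])
       (use distinguishesD[OF that assms(4,5)] small \<open>0 < x\<close> in \<open>auto simp: x_def\<close>)
  moreover have "\<exists>G\<in>F. queries_at_least A n G x" if "estimates_triangles C p n m A" for A
    by (rule queries_needed[OF assms(4,5) simple G0(1) deg rare, where ?S0.0 = "{0}" and ?S1.0 = "{x. x \<noteq> 0}" and p = p])
       (use estimates_trianglesD[OF that assms(1) G0 assms(4,5)] F \<open>0 < T\<close> small \<open>0 < x\<close> in \<open>auto simp: x_def\<close>)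
  ultimately show ?thesis unfolding hard_def x_def using F by metis
qed

text \<open>
  Here \<open>m \<le> n\<^sup>2 / (2 + \<theta>)\<^sup>2\<close>, and \<open>\<eta> * sqrt m\<close> is the size of the blocks among which the swapped
  edges are hidden, small enough that a complete bipartite graph with \<open>m\<close> edges fits next to them.
\<close>

lemma hard_family_sparse:
  fixes n m t :: nat and C p \<theta> \<eta> c :: real
  assumes "1 \<le> C" "1 / 2 < p" and \<theta>: "0 < \<theta>" "\<theta> < 1" "\<eta> = \<theta> / 10"
    and c: "0 < c" "c \<le> (2 * p - 1) * \<eta> ^ 3 / 16"
    and n: "(2 + \<theta>) * sqrt (real m) \<le> real n"
    and t: "1 \<le> t" "real t < (\<eta> * sqrt (real m) / 2) ^ 3"
  shows "\<exists>G0 F. simple_graph n G0 \<and> card G0 = m \<and> triangles G0 = 0 \<and> F \<noteq> {} \<and>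
    (\<forall>G\<in>F. simple_graph n G \<and> card G = m \<and> real t / 4 \<le> real (triangles G) \<and> triangles G \<le> t) \<and>
    hard C p n m c G0 F"
proof -
  define s where "s = sqrt (real m)"
  have s: "0 \<le> s" "s ^ 2 = real m" by (simp_all add: s_def)
  have \<eta>: "0 < \<eta>" "\<eta> < 1 / 10" using \<theta> by auto
  \<comment> \<open>The range for \<open>t\<close> would be empty if \<open>\<eta> * s\<close> were
    at most \<open>2\<close>; hence rounding \<open>\<eta> * s\<close> down to \<open>q\<close>
    loses at most half of it.\<close>
  have "1 < (\<eta> * s / 2) ^ 3" using t by (simp add: s_def)
  then have \<eta>s: "2 < \<eta> * s"
    using power_le_one[of "\<eta> * s / 2" 3] \<eta> s(1) by (smt (verit) divide_nonneg_nonneg mult_nonneg_nonneg field_sum_of_halves)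
  then have s_pos: "0 < s" using \<eta> s(1) by (cases "s = 0") auto
  define q where "q = nat \<lfloor>\<eta> * s\<rfloor>"
  have q: "real q \<le> \<eta> * s" "\<eta> * s < real q + 1" using \<eta>s by (simp_all add: q_def)
  then have q2: "\<eta> * s / 2 \<le> real q" "1 \<le> q" using \<eta>s by linarith+
  define f where "f = nat \<lceil>s\<rceil>"
  have f: "s \<le> real f" "real f \<le> s + 1" using s(1) unfolding f_def by linarith+
  define \<tau> where "\<tau> = min t q"
  have \<tau>: "1 \<le> \<tau>" "\<tau> \<le> q" "\<tau> \<le> t" using t q2 by (simp_all add: \<tau>_def)
  \<comment> \<open>Ideally \<open>k^2 * \<tau> = t\<close>. Since the root is at least
    \<open>1\<close>, rounding it down loses less than a factor \<open>2\<close>, and the number of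
    triangles less than a factor \<open>4\<close>.\<close>
  define k where "k = nat \<lfloor>sqrt (real t / real \<tau>)\<rfloor>"
  have t\<tau>: "1 \<le> real t / real \<tau>" using \<tau> by simp
  then have "1 \<le> sqrt (real t / real \<tau>)" by simp
  then have k: "real k \<le> sqrt (real t / real \<tau>)" "sqrt (real t / real \<tau>) < real k + 1" "1 \<le> k"
    by (simp_all add: k_def, linarith+)
  have "real k ^ 2 \<le> sqrt (real t / real \<tau>) ^ 2" using k(1) by (intro power_mono) auto
  then have "real k ^ 2 \<le> real t / real \<tau>" using t\<tau> by simp
  then have "real k ^ 2 * real \<tau> \<le> real t" using \<tau> by (simp add: le_divide_eq)
  then have kt: "k ^ 2 * \<tau> \<le> t" by (metis of_nat_le_iff of_nat_mult of_nat_power)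
  have "sqrt (real t / real \<tau>) ^ 2 \<le> (2 * real k) ^ 2" using k t\<tau> by (intro power_mono) auto
  then have "real t / real \<tau> \<le> 4 * real k ^ 2" using t\<tau> by (simp add: power_mult_distrib)
  then have tk: "real t / 4 \<le> real (k ^ 2 * \<tau>)" using \<tau> by (simp add: divide_le_eq field_simps)
  \<comment> \<open>The upper bound on \<open>t\<close> is what makes blocks of size
    \<open>k\<close> fit: for \<open>\<tau> = q\<close> it yields \<open>k^2 < q^2\<close>.\<close>
  have tq: "real t < real q ^ 3"
    using t(2) power_mono[of "\<eta> * s / 2" "real q" 3] q2(1) \<eta>s unfolding s_def by linarith
  have kq: "k \<le> q \<and> (k = 1 \<or> \<tau> = q)"
  proof (cases "t \<le> q")
    case True
    then have "\<tau> = t" by (simp add: \<tau>_def)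
    then show ?thesis using t q2 by (simp add: k_def)
  next
    case False
    then have "\<tau> = q" by (simp add: \<tau>_def)
    with kt have "real (k ^ 2 * q) \<le> real t" by (intro of_nat_mono) simp
    with tq have "real k ^ 2 * real q < real q ^ 2 * real q" by (simp add: power3_eq_cube power2_eq_square)
    then have "real k ^ 2 < real q ^ 2" using q2 by simp
    then have "real k < real q" by (rule power2_less_imp_less) simp
    with \<open>\<tau> = q\<close> show ?thesis by simp
  qed
  \<comment> \<open>Apart from \<open>E0\<close> the base graph has at most \<open>4 * q^2\<close>
    edges because \<open>\<tau> \<le> q\<close>; these must not exceed \<open>m\<close>.\<close>
  have "\<eta> * s \<le> 1 / 2 * s" using \<eta> s(1) by (intro mult_right_mono) auto
  then have "real q ^ 2 \<le> (1 / 2 * s) ^ 2" using q(1) by (intro power_mono) linarith+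
  then have "4 * real q ^ 2 \<le> real m" by (simp add: power_mult_distrib power_divide s(2))
  then have "real (4 * q ^ 2) \<le> real m" by simp
  then have "4 * q ^ 2 \<le> m" by (simp only: of_nat_le_iff)
  moreover have "q * \<tau> \<le> q ^ 2" using \<tau> by (simp add: power2_eq_square)
  ultimately have m1: "2 * q ^ 2 + 2 * q * \<tau> \<le> m" by (simp add: mult.assoc)
  have "s ^ 2 \<le> real f ^ 2" using f s(1) by (intro power_mono)
  then have "real m \<le> real (f ^ 2)" by (simp add: s(2))
  then have "m \<le> f ^ 2" by (simp only: of_nat_le_iff)
  then have m2: "m \<le> 2 * q ^ 2 + 2 * q * \<tau> + f ^ 2" by simp
  \<comment> \<open>This is the reason for \<open>\<eta> = \<theta> / 10\<close>: five sets of size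
    \<open>q\<close> and the rounding in \<open>f\<close> together take at most
    \<open>10 * \<eta> * s = \<theta> * s\<close> vertices.\<close>
  have "5 * real q + 2 * real f \<le> 5 * (\<eta> * s) + 2 * s + 2" using q(1) f(2) by linarith
  also have "\<dots> \<le> 10 * (\<eta> * s) + 2 * s" using \<eta>s by linarith
  also have "\<dots> = (2 + \<theta>) * s" by (simp add: \<theta>(3) algebra_simps)
  finally have "real (5 * q + 2 * f) \<le> real n" using n by (simp add: s_def)
  then have "5 * q + 2 * f \<le> n" by (simp only: of_nat_le_iff)
  from hidden_family_exists[OF k(3) kq[THEN conjunct1] \<tau>(2) this m1 m2] obtain G0 F where
    F: "finite F" "F \<noteq> {}" and G0: "simple_graph n G0" "card G0 = m" "triangles G0 = 0"
    and GF: "\<And>G. G \<in> F \<Longrightarrow> simple_graph n G \<and> card G = m \<and> triangles G = k ^ 2 * \<tau>"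
    and deg: "\<And>G v. G \<in> F \<Longrightarrow> vertex_degree G v = vertex_degree G0 v"
    and rare: "\<And>e. real (card {G \<in> F. e \<in> changed G0 G}) \<le> (real k ^ 2 / real q ^ 2) * real (card F)"
    by blast
  have T: "0 < k ^ 2 * \<tau>" using k \<tau> by simp
  have m_pos: "0 < m" using s s_pos by (cases m) auto
  have sq: "s / real q \<le> 2 / \<eta>" using q2 \<eta> by (simp add: field_simps)
  \<comment> \<open>For \<open>\<tau> = q\<close> the first entry of the minimum gives
    \<open>(s / q)^3\<close>, as \<open>k^2\<close> cancels; for \<open>k = 1\<close> the second
    gives \<open>(s / q)^2\<close>. Both are controlled by
    \<open>s / q \<le> 2 / \<eta>\<close>.\<close>
  have "min (real m powr (3 / 2) / real (k ^ 2 * \<tau>)) (real m) * (real k ^ 2 / real q ^ 2) \<le> 8 / \<eta> ^ 3"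
    (is "?l * ?\<rho> \<le> _")
  proof (cases "\<tau> = q")
    case True
    have "?l * ?\<rho> \<le> (s ^ 3 / (real k ^ 2 * real q)) * ?\<rho>"
      by (intro mult_right_mono) (simp_all add: True powr_three_halves s_def)
    also have "\<dots> = (s / real q) ^ 3"
      using k q2 by (simp add: power_divide power2_eq_square power3_eq_cube)
    also have "\<dots> \<le> (2 / \<eta>) ^ 3" using sq s by (intro power_mono) auto
    finally show ?thesis by (simp add: power_divide)
  next
    case False
    with kq have "k = 1" by simp
    have "?l * ?\<rho> \<le> real m * ?\<rho>" by (intro mult_right_mono) auto
    also have "\<dots> = (s / real q) ^ 2" using \<open>k = 1\<close> by (simp add: power_divide s(2))
    also have "\<dots> \<le> (2 / \<eta>) ^ 2" using sq s by (intro power_mono) auto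
    also have "\<dots> \<le> (2 / \<eta>) ^ 3" using \<eta> by (intro power_increasing) (auto simp: field_simps)
    finally show ?thesis by (simp add: power_divide)
  qed
  \<comment> \<open>The bound on \<open>c\<close> leaves half of the available gap
    \<open>2 * p - 1\<close>, which makes the inequality strict.\<close>
  then have "c * (?l * ?\<rho>) \<le> c * (8 / \<eta> ^ 3)" using c(1) by (intro mult_left_mono) auto
  also have "\<dots> \<le> ((2 * p - 1) * \<eta> ^ 3 / 16) * (8 / \<eta> ^ 3)" using c(2) \<eta> by (intro mult_right_mono) auto
  also have "\<dots> = (2 * p - 1) / 2" using \<eta> by simp
  also have "\<dots> < 2 * p - 1" using assms(2) by simp
  finally have "c * ?l * ?\<rho> < 2 * p - 1" by (simp only: mult.assoc)
  then have "hard C p n m c G0 F"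
    by (intro hard_family[OF assms(1) c(1) m_pos F T G0 GF deg rare])
  moreover have "\<forall>G\<in>F. simple_graph n G \<and> card G = m \<and> real t / 4 \<le> real (triangles G) \<and> triangles G \<le> t"
    using GF tk kt by auto
  ultimately show ?thesis using G0 F by blast
qed

text \<open>Below the threshold \<open>(\<eta> * sqrt m / 2)^3\<close> the hidden family fits. Above
  it \<open>t\<close> is within a constant factor of \<open>m^(3/2)\<close>, and a single
  clique-like graph against a bipartite one suffices.\<close>

lemma hard_instances:
  assumes "1 \<le> C" "1 / 2 < p" "3 / 16 \<le> \<kappa>" "\<kappa> < 1 / 4"
  shows "\<exists>c>0. \<exists>b>0. \<forall>n m t :: nat. 4 \<le> n \<and> 3 \<le> m \<and> real m \<le> \<kappa> * real n ^ 2 \<and>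
      1 \<le> t \<and> real t \<le> real m powr (3 / 2) \<longrightarrow>
    (\<exists>G0 F. simple_graph n G0 \<and> card G0 = m \<and> triangles G0 = 0 \<and> F \<noteq> {} \<and>
       (\<forall>G\<in>F. simple_graph n G \<and> card G = m \<and>
          real t / 27 \<le> real (triangles G) \<and> real (triangles G) \<le> b * real t) \<and>
       hard C p n m c G0 F)"
proof -
  \<comment> \<open>With \<open>2 + \<theta> = 1 / sqrt \<kappa>\<close> the assumption on
    \<open>m\<close> becomes \<open>(2 + \<theta>) * sqrt m \<le> n\<close>, and
    \<open>\<kappa> < 1 / 4\<close> means \<open>\<theta> > 0\<close>.\<close>
  define \<theta> where "\<theta> = 1 / sqrt \<kappa> - 2"
  define \<eta> where "\<eta> = \<theta> / 10"
  \<comment> \<open>The entry \<open>1 / 27\<close> matches the triangle count of the clique-like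
    graph, the other one the requirement of the hidden family.\<close>
  define c where "c = min (1 / 27) ((2 * p - 1) * \<eta> ^ 3 / 16)"
  \<comment> \<open>The reciprocal of \<open>(\<eta> / 2)^3\<close>, so that
    \<open>m^(3/2) \<le> b * t\<close> for \<open>t\<close> above the threshold.\<close>
  define b where "b = 8 / \<eta> ^ 3"
  have sqrt_\<kappa>: "1 / 3 < sqrt \<kappa>" "sqrt \<kappa> < 1 / 2"
    using assms(3,4) real_less_rsqrt[of "1 / 3" \<kappa>] real_less_lsqrt[of "1 / 2" \<kappa>]
    by (simp_all add: power2_eq_square)
  have "2 * sqrt \<kappa> < 1" "1 < 3 * sqrt \<kappa>" using sqrt_\<kappa> by auto
  then have \<theta>: "0 < \<theta>" "\<theta> < 1" using sqrt_\<kappa> assms(3) by (auto simp: \<theta>_def less_divide_eq divide_less_eq)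
  then have \<eta>: "0 < \<eta>" "\<eta> < 1" by (auto simp: \<eta>_def)
  have "0 < c" using assms(2) \<eta> by (simp add: c_def)
  have c_le: "c \<le> (2 * p - 1) * \<eta> ^ 3 / 16" unfolding c_def by (rule min.cobounded2)
  have "\<eta> ^ 3 \<le> 1" using \<eta> by (intro power_le_one) auto
  then have b: "1 \<le> b" using \<eta> by (simp add: b_def le_divide_eq)
  have "\<exists>G0 F. simple_graph n G0 \<and> card G0 = m \<and> triangles G0 = 0 \<and> F \<noteq> {} \<and>
       (\<forall>G\<in>F. simple_graph n G \<and> card G = m \<and>
          real t / 27 \<le> real (triangles G) \<and> real (triangles G) \<le> b * real t) \<and>
       hard C p n m c G0 F"
    if n: "4 \<le> n" and m: "3 \<le> m" "real m \<le> \<kappa> * real n ^ 2" and t: "1 \<le> t" "real t \<le> real m powr (3 / 2)"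
    for n m t :: nat
  proof (cases "real t < (\<eta> * sqrt (real m) / 2) ^ 3")
    case True
    have "sqrt (real m) \<le> sqrt (\<kappa> * real n ^ 2)" using m(2) by simp
    also have "\<dots> = sqrt \<kappa> * real n" by (simp add: real_sqrt_mult)
    finally have "(2 + \<theta>) * sqrt (real m) \<le> real n"
      using assms(3) by (simp add: \<theta>_def pos_divide_le_eq mult.commute)
    from hard_family_sparse[OF assms(1,2) \<theta> \<eta>_def \<open>0 < c\<close> c_le this t(1) True]
    obtain G0 F where GF: "simple_graph n G0" "card G0 = m" "triangles G0 = 0" "F \<noteq> {}" "hard C p n m c G0 F"
      "\<And>G. G \<in> F \<Longrightarrow> simple_graph n G \<and> card G = m \<and> real t / 4 \<le> real (triangles G) \<and> triangles G \<le> t"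
      by blast
    have "real t / 27 \<le> real (triangles G) \<and> real (triangles G) \<le> b * real t" if "G \<in> F" for G
    proof -
      have "real t \<le> b * real t" using b mult_right_mono[of 1 b "real t"] by simp
      moreover have "real (triangles G) \<le> real t" using GF(6)[OF that] by simp
      ultimately show ?thesis using GF(6)[OF that] by linarith
    qed
    with GF show ?thesis by (intro exI[of _ G0] exI[of _ F]) blast
  next
    case False
    have "\<kappa> * real n ^ 2 \<le> 1 / 4 * real n ^ 2" using assms(4) by (intro mult_right_mono) auto
    with m(2) have m4: "real m \<le> real n ^ 2 / 4" by simp
    from triangle_free_graph_exists[OF this] obtain G0
      where G0: "simple_graph n G0" "card G0 = m" "triangles G0 = 0" by blast
    from clique_like_graph_exists[OF m(1) m4 n] obtain G where G: "simple_graph n G" "card G = m"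
      "sqrt (real m) ^ 3 / 27 \<le> real (triangles G)" "real (triangles G) \<le> sqrt (real m) ^ 3" by blast
    have pw: "real m powr (3 / 2) = sqrt (real m) ^ 3" by (simp add: powr_three_halves)
    have "0 < sqrt (real m) ^ 3" using m(1) by simp
    with G(3) have "0 < real (triangles G)" by linarith
    then have tri: "0 < triangles G" by simp
    have "c * real m powr (3 / 2) \<le> 1 / 27 * real m powr (3 / 2)"
      by (intro mult_right_mono) (auto simp: c_def)
    also have "\<dots> \<le> real (triangles G)" using G(3) by (simp add: pw)
    finally have "hard C p n m c G0 {G}"
      by (intro hard_single[OF assms(1,2) \<open>0 < c\<close> _ G0 G(1,2) tri]) (use m(1) in auto)
    moreover have "real t / 27 \<le> real (triangles G)" using t(2) G(3) by (simp add: pw)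
    moreover have "real (triangles G) \<le> b * real t"
    proof -
      have "sqrt (real m) ^ 3 = b * (\<eta> * sqrt (real m) / 2) ^ 3"
        using \<eta> by (simp add: b_def power_mult_distrib power_divide)
      also have "\<dots> \<le> b * real t" using False b by (intro mult_left_mono) auto
      finally show ?thesis using G(4) by simp
    qed
    ultimately show ?thesis using G0 G(1,2) by (intro exI[of _ G0] exI[of _ "{G}"]) auto
  qed
  then show ?thesis using \<open>0 < c\<close> b by (intro exI[of _ c] exI[of _ b] conjI allI impI) auto
qed

text \<open>Moves \<open>m\<close> into the range from \<open>3\<close> to
  \<open>\<kappa> * n^2\<close> and \<open>t\<close> below \<open>M^(3/2)\<close>, at the cost of
  constant factors. The range contains \<open>3\<close> because \<open>n \<ge> 4\<close> and
  \<open>\<kappa> \<ge> 3 / 16\<close>.\<close>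

lemma parameters:
  fixes n m t :: nat and \<kappa> :: real
  assumes \<kappa>: "3 / 16 \<le> \<kappa>" "\<kappa> < 1 / 4" and n: "4 \<le> n" and m: "1 \<le> m" "m \<le> n choose 2"
    and t: "1 \<le> t" "real t \<le> real m powr (3 / 2)"
  shows "\<exists>M t' :: nat. 3 \<le> M \<and> real M \<le> \<kappa> * real n ^ 2 \<and> (3 \<le> m \<and> real m \<le> \<kappa> * real n ^ 2 \<longrightarrow> M = m) \<and>
    real m / 4 \<le> real M \<and> real M \<le> 3 * real m \<and>
    1 \<le> t' \<and> real t' \<le> real M powr (3 / 2) \<and> real t / 16 \<le> real t' \<and> t' \<le> t"
proof -
  have "4 ^ 2 \<le> real n ^ 2" using n by (intro power_mono) auto
  then have n2: "16 \<le> real n ^ 2" by simp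
  have \<kappa>n: "3 \<le> \<kappa> * real n ^ 2"
    using mult_mono[OF \<kappa>(1) n2] \<kappa> by simp
  have "\<exists>M. 3 \<le> M \<and> real M \<le> \<kappa> * real n ^ 2 \<and> (3 \<le> m \<and> real m \<le> \<kappa> * real n ^ 2 \<longrightarrow> M = m) \<and>
    real m / 4 \<le> real M \<and> real M \<le> 3 * real m"
  proof (cases "m < 3")
    case True
    then show ?thesis using \<kappa>n m(1) by (intro exI[of _ 3]) auto
  next
    case m3: False
    show ?thesis
    proof (cases "real m \<le> \<kappa> * real n ^ 2")
      case True
      then show ?thesis using m3 by (intro exI[of _ m]) auto
    next
      case False
      \<comment> \<open>Here \<open>m / 4 \<le> n^2 / 8\<close>, while \<open>M\<close> exceeds
        \<open>3 * n^2 / 16 - 1\<close>, which is at least \<open>n^2 / 8\<close> because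
        \<open>n^2 \<ge> 16\<close>.\<close>
      define M where "M = nat \<lfloor>\<kappa> * real n ^ 2\<rfloor>"
      have M: "real M \<le> \<kappa> * real n ^ 2" "\<kappa> * real n ^ 2 < real M + 1" "3 \<le> M"
        using \<kappa>n by (simp_all add: M_def, linarith+)
      have "real m \<le> real n * (real n - 1) / 2"
        using of_nat_mono[OF m(2), where 'a = real] by (simp add: real_choose_2)
      also have "\<dots> \<le> real n ^ 2 / 2" by (simp add: power2_eq_square right_diff_distrib)
      finally have "real m \<le> real n ^ 2 / 2" .
      moreover have "3 / 16 * real n ^ 2 \<le> \<kappa> * real n ^ 2" using \<kappa> by (intro mult_right_mono) auto
      ultimately show ?thesis
        using M False m3 n2 by (intro exI[of _ M]) auto
    qed
  qed
  then obtain M where M: "3 \<le> M" "real M \<le> \<kappa> * real n ^ 2" "3 \<le> m \<and> real m \<le> \<kappa> * real n ^ 2 \<longrightarrow> M = m"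
    "real m / 4 \<le> real M" "real M \<le> 3 * real m" by blast
  define y where "y = real M powr (3 / 2)"
  have y1: "1 \<le> y" unfolding y_def using M(1) by (intro ge_one_powr_ge_zero) auto
  have "real m powr (3 / 2) \<le> (4 * real M) powr (3 / 2)" using M(4) by (intro powr_mono2) auto
  also have "\<dots> = 8 * y" by (simp add: y_def powr_mult powr_three_halves[of 4])
  finally have ty: "real t \<le> 8 * y" using t(2) by simp
  have "\<exists>t'. 1 \<le> t' \<and> real t' \<le> y \<and> real t / 16 \<le> real t' \<and> t' \<le> t"
  proof (cases "real t \<le> y")
    case True
    then show ?thesis using t(1) by (intro exI[of _ t]) auto
  next
    case False
    \<comment> \<open>The factor \<open>16\<close> arises from
      \<open>t \<le> 8 * y < 8 * (t' + 1) \<le> 16 * t'\<close>.\<close>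
    define t' where "t' = nat \<lfloor>y\<rfloor>"
    have t': "real t' \<le> y" "y < real t' + 1" "1 \<le> t'" using y1 by (simp_all add: t'_def, linarith+)
    then have "real t' < real t" using False by linarith
    then have "t' \<le> t" by simp
    with t' ty show ?thesis by (intro exI[of _ t']) auto
  qed
  with M show ?thesis unfolding y_def by blast
qed

text \<open>The instances have \<open>M\<close> edges because \<open>m\<close> itself cannot always
  serve: a triangle-free graph has at most \<open>n^2 / 4\<close> edges and a triangle needs three.
  For \<open>n = 3\<close> no number of edges admits both kinds of graphs. With
  \<open>\<kappa>\<close> strictly below \<open>1 / 4\<close>, there is room for the hidden part
  next to a bipartite graph with up to \<open>m\<close> edges.\<close>

theorem theoremm:
  fixes C p \<kappa> :: real
  assumes "1 \<le> C" and "1 / 2 < p" and "\<kappa> < 1 / 4"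
  shows "\<exists>c>0. \<exists>a>0. \<exists>b>0. \<exists>\<alpha>>0. \<exists>\<beta>>0. \<forall>n m t :: nat.
    4 \<le> n \<and> 1 \<le> m \<and> m \<le> n choose 2 \<and>
    1 \<le> t \<and> t \<le> n choose 3 \<and> real t \<le> real m powr (3 / 2) \<longrightarrow>
    (\<exists>M G0 F.
       (3 \<le> m \<and> real m \<le> \<kappa> * real n ^ 2 \<longrightarrow> M = m) \<and>
       \<alpha> * real m \<le> real M \<and> real M \<le> \<beta> * real m \<and>
       simple_graph n G0 \<and> card G0 = M \<and> triangles G0 = 0 \<and>
       F \<noteq> {} \<and>
       (\<forall>G\<in>F. simple_graph n G \<and> card G = M \<and>
          a * real t \<le> real (triangles G) \<and> real (triangles G) \<le> b * real t) \<and>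
       (\<forall>A. distinguishes p n G0 F A \<longrightarrow>
          (\<exists>G\<in>F. queries_at_least A n G
             (c * min (real M powr (3 / 2) / real (triangles G)) (real M)))) \<and>
       (\<forall>A. estimates_triangles C p n M A \<longrightarrow>
          (\<exists>G\<in>F. queries_at_least A n G
             (c * min (real M powr (3 / 2) / real (triangles G)) (real M)))))"
proof -
  \<comment> \<open>Enlarging \<open>\<kappa>\<close> only widens the range where
    \<open>M = m\<close> holds, so the lower bound \<open>3 / 16\<close> costs nothing.\<close>
  define \<kappa>' where "\<kappa>' = max \<kappa> (3 / 16)"
  have \<kappa>': "3 / 16 \<le> \<kappa>'" "\<kappa>' < 1 / 4" "\<kappa> \<le> \<kappa>'" using assms(3) by (auto simp: \<kappa>'_def)
  from hard_instances[OF assms(1,2) \<kappa>'(1,2)] obtain c b where "0 < c" "0 < b" and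
    inst: "\<And>n m t :: nat. 4 \<le> n \<Longrightarrow> 3 \<le> m \<Longrightarrow> real m \<le> \<kappa>' * real n ^ 2 \<Longrightarrow>
      1 \<le> t \<Longrightarrow> real t \<le> real m powr (3 / 2) \<Longrightarrow>
    \<exists>G0 F. simple_graph n G0 \<and> card G0 = m \<and> triangles G0 = 0 \<and> F \<noteq> {} \<and>
       (\<forall>G\<in>F. simple_graph n G \<and> card G = m \<and>
          real t / 27 \<le> real (triangles G) \<and> real (triangles G) \<le> b * real t) \<and>
       hard C p n m c G0 F" by blast
  \<comment> \<open>The witness \<open>1 / 432\<close> is \<open>1 / (16 * 27)\<close>: the factor
    \<open>16\<close> is lost from \<open>t\<close> to \<open>t'\<close> and \<open>27\<close> from
    \<open>t'\<close> to the number of triangles. The values \<open>1 / 4\<close> and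
    \<open>3\<close> are those of \<open>parameters\<close>.\<close>
  show ?thesis
  proof (rule exI[of _ c], rule conjI[OF \<open>0 < c\<close>], rule exI[of _ "1 / 432"], rule conjI, simp,
      rule exI[of _ b], rule conjI[OF \<open>0 < b\<close>], rule exI[of _ "1 / 4"], rule conjI, simp,
      rule exI[of _ 3], rule conjI, simp, intro allI impI, elim conjE)
    fix n m t :: nat
    assume *: "4 \<le> n" "1 \<le> m" "m \<le> n choose 2" "1 \<le> t" "real t \<le> real m powr (3 / 2)"
    from parameters[OF \<kappa>'(1,2) *] obtain M t' :: nat where
      M: "3 \<le> M" "real M \<le> \<kappa>' * real n ^ 2" "3 \<le> m \<and> real m \<le> \<kappa>' * real n ^ 2 \<longrightarrow> M = m"
      "real m / 4 \<le> real M" "real M \<le> 3 * real m"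
      and t': "1 \<le> t'" "real t' \<le> real M powr (3 / 2)" "real t / 16 \<le> real t'" "t' \<le> t" by blast
    from inst[OF *(1) M(1,2) t'(1,2)] obtain G0 F where
      GF: "simple_graph n G0" "card G0 = M" "triangles G0 = 0" "F \<noteq> {}" and hard: "hard C p n M c G0 F"
      and tri: "\<And>G. G \<in> F \<Longrightarrow> simple_graph n G \<and> card G = M \<and>
          real t' / 27 \<le> real (triangles G) \<and> real (triangles G) \<le> b * real t'" by blast
    have "\<kappa> * real n ^ 2 \<le> \<kappa>' * real n ^ 2" using \<kappa>'(3) by (intro mult_right_mono) auto
    then have "3 \<le> m \<and> real m \<le> \<kappa> * real n ^ 2 \<longrightarrow> M = m" using M(3) by auto
    moreover have "1 / 432 * real t \<le> real (triangles G) \<and> real (triangles G) \<le> b * real t" if "G \<in> F" for G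
    proof -
      have "b * real t' \<le> b * real t" using t'(4) \<open>0 < b\<close> by (intro mult_left_mono) auto
      then show ?thesis using tri[OF that] t'(3) by linarith
    qed
    ultimately show "\<exists>M G0 F.
       (3 \<le> m \<and> real m \<le> \<kappa> * real n ^ 2 \<longrightarrow> M = m) \<and>
       1 / 4 * real m \<le> real M \<and> real M \<le> 3 * real m \<and>
       simple_graph n G0 \<and> card G0 = M \<and> triangles G0 = 0 \<and>
       F \<noteq> {} \<and>
       (\<forall>G\<in>F. simple_graph n G \<and> card G = M \<and>
          1 / 432 * real t \<le> real (triangles G) \<and> real (triangles G) \<le> b * real t) \<and>
       (\<forall>A. distinguishes p n G0 F A \<longrightarrow>
          (\<exists>G\<in>F. queries_at_least A n G
             (c * min (real M powr (3 / 2) / real (triangles G)) (real M)))) \<and>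
       (\<forall>A. estimates_triangles C p n M A \<longrightarrow>
          (\<exists>G\<in>F. queries_at_least A n G
             (c * min (real M powr (3 / 2) / real (triangles G)) (real M))))"
      using M(4,5) GF tri hard[unfolded hard_def] by (intro exI[of _ M] exI[of _ G0] exI[of _ F]) auto
  qed
qed

end
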